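(* Let $f$ be a valid feedback function with characteristic exponent $h$ (in which case $\sum_{j}f(j)^{-1}<+\infty$). For any fixed initial conditions $(x,y)\in\mathbb{N}^2$ of the two-bin balls-in-bins process with feedback function $f$, there exists a number $c>0$, depending only on $x$, $y$ and $f$, such that, as $n\to+\infty$, $$\mathbf{Pr}_{(x,y)}(L>n)\sim c\,S_1(n)\sim c\,\frac{n}{(h(n)-1)f(n)},$$ where $L$ is the number of balls in the losing bin and $S_1(n)=\sum_{j=n}^{+\infty}\frac{1}{f(j)}$.
   Context: $\mathbb{N}=\{1,2,3,\dots\}$; $a_n\sim b_n$ means $a_n/b_n\to 1$. Two-bin balls-in-bins process with feedback function $f:\mathbb{N}\to(0,+\infty)$: the discrete-time Markov chain $\{(I_1(m),I_2(m))\}_{m\geq 0}$ on $\mathbb{N}^2$ in which at each time $m\ge 1$ exactly one ball is added, to bin $i_m\in\{1,2\}$ (so $I_{i_m}(m)=I_{i_m}(m-1)+1$ and the other coordinate is unchanged), where, conditionally on the past, $i_m=i$ with probability $f(I_i(m-1))/(f(I_1(m-1))+f(I_2(m-1)))$. $\mathbf{Pr}_{u}$ denotes probability when the initial state $(I_1(0),I_2(0))$ is $u\in\mathbb{N}^2$. When $\sum_j f(j)^{-1}<+\infty$, it is known that almost surely exactly one bin receives all but finitely many of the balls. The other bin is called the losing bin, and the losing number $L$ is the (almost surely finite) final number of balls in the losing bin, i.e. $L=\lim_{m\to\infty} I_i(m)$ for $i$ the losing bin. Valid feedback function: an increasing function $f:\mathbb{N}\to(0,+\infty)$ with $f(1)=1$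 that can be extended to a $C^1$ function $g:[1,+\infty)\to(0,+\infty)$ such that, with $h(x)= x(\ln g)'(x)$ for $x\ge 1$: (1) $\liminf_{x\to+\infty}h(x)>1$; (2) $\lim_{x\to+\infty}x^{-1/4}h(x)=0$; (3) there exist $C>0$ and $x_0\geq 1$ such that for all $\epsilon\in(0,1)$ and all $x\ge x_0$, $\sup_{x\le t\le x^{1+\epsilon}}\left|\frac{h(t)}{h(x)}-1\right|\le C\epsilon$. The function $h$ is called the characteristic exponent of $f$, and $f$ also denotes the extension $g$. *)

theory Defs
  imports "HOL-Probability.Probability" "HOL-Library.Landau_Symbols"
begin

(* Feedback functions on {1, 2, 3, ...} are total functions on nat; the value at 0 is
   irrelevant and all conditions below are restricted to arguments \<ge> 1. *)

definition C1_extension :: "(nat \<Rightarrow> real) \<Rightarrow> (real \<Rightarrow> real) \<Rightarrow> bool" where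
  "C1_extension f g \<longleftrightarrow>
     (\<forall>n\<ge>1. g (real n) = f n) \<and>
     (\<forall>x\<ge>1. g x > 0) \<and>
     (\<exists>g'. continuous_on {1..} g' \<and>
           (\<forall>x\<ge>1. (g has_real_derivative g' x) (at x within {1..})))"

(* The derivative is one-sided at the endpoint 1. *)
definition char_exponent :: "(real \<Rightarrow> real) \<Rightarrow> real \<Rightarrow> real" where
  "char_exponent g x = x * vector_derivative (\<lambda>t. ln (g t)) (at x within {1..})"

(* In the third condition, h x = 0 with x \<ge> x0 is excluded automatically: since h t / 0 = 0,
   the supremum would then be 1 for every \<epsilon>. *)
definition valid_exponent :: "(real \<Rightarrow> real) \<Rightarrow> bool" where
  "valid_exponent h \<longleftrightarrow>
     Liminf at_top (\<lambda>x. ereal (h x)) > 1 \<and>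
     ((\<lambda>x. x powr (-1/4) * h x) \<longlongrightarrow> 0) at_top \<and>
     (\<exists>C>0. \<exists>x0\<ge>1. \<forall>\<epsilon>\<in>{0<..<1}. \<forall>x\<ge>x0.
        (SUP t\<in>{x..x powr (1 + \<epsilon>)}. ereal \<bar>h t / h x - 1\<bar>) \<le> ereal (C * \<epsilon>))"

definition valid_extension :: "(nat \<Rightarrow> real) \<Rightarrow> (real \<Rightarrow> real) \<Rightarrow> bool" where
  "valid_extension f g \<longleftrightarrow> C1_extension f g \<and> valid_exponent (char_exponent g)"

definition valid_feedback :: "(nat \<Rightarrow> real) \<Rightarrow> bool" where
  "valid_feedback f \<longleftrightarrow>
     (\<forall>n\<ge>1. f n > 0) \<and> mono_on {1..} f \<and> f 1 = 1 \<and> (\<exists>g. valid_extension f g)"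

definition bins_step :: "(nat \<Rightarrow> real) \<Rightarrow> nat \<times> nat \<Rightarrow> (nat \<times> nat) pmf" where
  "bins_step f s =
     map_pmf (\<lambda>first. if first then (Suc (fst s), snd s) else (fst s, Suc (snd s)))
       (bernoulli_pmf (f (fst s) / (f (fst s) + f (snd s))))"

(* Law of the coordinate at time m given the coordinates before time m. *)
definition bins_kernel ::
  "(nat \<Rightarrow> real) \<Rightarrow> nat \<times> nat \<Rightarrow> nat \<Rightarrow> (nat \<Rightarrow> nat \<times> nat) \<Rightarrow> (nat \<times> nat) measure" where
  "bins_kernel f u m \<omega> =
     measure_pmf (case m of 0 \<Rightarrow> return_pmf u | Suc k \<Rightarrow> bins_step f (\<omega> k))"

(* Law, on path space, of the chain started at u (Ionescu-Tulcea); on it the process is the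
   coordinate process. Theorem bins_measure_cylinder below is the usual characterisation. *)
definition bins_measure :: "(nat \<Rightarrow> real) \<Rightarrow> nat \<times> nat \<Rightarrow> (nat \<Rightarrow> nat \<times> nat) measure" where
  "bins_measure f u =
     projective_family.lim UNIV
       (Ionescu_Tulcea.CI (bins_kernel f u) (\<lambda>_. count_space UNIV)) (\<lambda>_. count_space UNIV)"

definition wins_fst :: "(nat \<Rightarrow> nat \<times> nat) \<Rightarrow> bool" where
  "wins_fst \<omega> \<longleftrightarrow> (\<forall>\<^sub>F m in sequentially. fst (\<omega> (Suc m)) = Suc (fst (\<omega> m)))"

definition wins_snd :: "(nat \<Rightarrow> nat \<times> nat) \<Rightarrow> bool" where
  "wins_snd \<omega> \<longleftrightarrow> (\<forall>\<^sub>F m in sequentially. snd (\<omega> (Suc m)) = Suc (snd (\<omega> m)))"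

(* The value 0 is a convention for paths without a winning bin, a null event when the
   reciprocals of f are summable. *)
definition losing_number :: "(nat \<Rightarrow> nat \<times> nat) \<Rightarrow> nat" where
  "losing_number \<omega> =
     (if wins_fst \<omega> then lim (\<lambda>m. snd (\<omega> m))
      else if wins_snd \<omega> then lim (\<lambda>m. fst (\<omega> m))
      else 0)"

definition losing_tail :: "(nat \<Rightarrow> real) \<Rightarrow> nat \<times> nat \<Rightarrow> nat \<Rightarrow> real" where
  "losing_tail f u n =
     measure (bins_measure f u) {\<omega> \<in> space (bins_measure f u). losing_number \<omega> > n}"

definition S1 :: "(nat \<Rightarrow> real) \<Rightarrow> nat \<Rightarrow> real" where
  "S1 f n = (\<Sum>j. 1 / f (n + j))"

lemma Ionescu_Tulcea_bins_kernel: "Ionescu_Tulcea (bins_kernel f u) (\<lambda>_. count_space UNIV)"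
proof (rule Ionescu_Tulcea.intro)
  show "bins_kernel f u i \<in>
      measurable (PiM {0..<i} (\<lambda>_. count_space UNIV)) (subprob_algebra (count_space UNIV))" for i
  proof (cases i)
    case 0
    have "measure_pmf (return_pmf u) \<in> space (subprob_algebra (count_space UNIV))"
      by (simp add: space_subprob_algebra measure_pmf.subprob_space_axioms)
    then show ?thesis
      using 0 by (simp add: bins_kernel_def[abs_def] del: atLeastLessThan_iff)
  next
    case (Suc k)
    have "(\<lambda>s. measure_pmf (bins_step f s)) \<in>
        measurable (count_space UNIV) (subprob_algebra (count_space UNIV))"
      by (auto simp: space_subprob_algebra measure_pmf.subprob_space_axioms)
    moreover have "(\<lambda>\<omega>. \<omega> k) \<in>
        measurable (PiM {0..<i} (\<lambda>_. count_space (UNIV :: (nat \<times> nat) set))) (count_space UNIV)"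
      using Suc by (intro measurable_component_singleton) auto
    ultimately show ?thesis
      using Suc by (simp add: bins_kernel_def[abs_def] measurable_compose)
  qed
  show "prob_space (bins_kernel f u i x)" for i x
    by (simp add: bins_kernel_def measure_pmf.prob_space_axioms)
qed

interpretation bins: Ionescu_Tulcea "bins_kernel f u" "\<lambda>_. count_space UNIV" for f u
  by (rule Ionescu_Tulcea_bins_kernel)

lemma sets_bins_measure: "sets (bins_measure f u) = sets (PiM UNIV (\<lambda>_. count_space UNIV))"
  by (simp add: bins_measure_def)

lemma space_bins_measure: "space (bins_measure f u) = UNIV"
  using sets_eq_imp_space_eq[OF sets_bins_measure] by (simp add: space_PiM)

lemma emeasure_bins_measure:
  assumes "X \<in> sets (PiM {0..<n} (\<lambda>_. count_space UNIV))"
  shows "emeasure (bins_measure f u) (prod_emb UNIV (\<lambda>_. count_space UNIV) {0..<n} X) =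
         emeasure (bins.C f u 0 n (\<lambda>_. undefined)) X"
proof -
  have "prod_emb {0..<n} (\<lambda>_. count_space UNIV) {0..<n} X = X"
    using sets.sets_into_space[OF assms] by (intro prod_emb_id) (simp add: space_PiM)
  then show ?thesis
    using bins.lim[OF _ assms, of f u] bins.emeasure_CI[OF _ assms, of n f u]
    by (simp add: bins_measure_def)
qed

lemma emeasure_bins_C:
  "emeasure (bins.C f u 0 n (\<lambda>_. undefined)) {restrict w {0..<n}} =
     (\<Prod>i<n. emeasure (bins_kernel f u i w) {w i})"
proof (induction n)
  case 0
  show ?case
    by (simp add: PiM_empty restrict_def emeasure_return[of _ "count_space {\<lambda>_. undefined}"]
        emeasure_return)
next
  case (Suc n)
  let ?M = "\<lambda>n. PiM {0..<n} (\<lambda>_. count_space (UNIV :: (nat \<times> nat) set))"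
  let ?C = "bins.C f u 0 n (\<lambda>_. undefined)"
  have sing: "{restrict w {0..<k}} \<in> sets (?M k)" for k
  proof -
    have "{restrict w {0..<k}} = PiE {0..<k} (\<lambda>i. {restrict w {0..<k} i})"
      by (rule PiE_singleton[symmetric]) simp
    also have "\<dots> \<in> sets (?M k)"
      by (rule sets_PiM_I_finite) auto
    finally show ?thesis .
  qed
  have space_C: "space ?C = space (?M n)"
    using bins.space_C[of "\<lambda>_. undefined" 0 f u n] by simp
  have kernel: "bins_kernel f u n (restrict w {0..<n}) = bins_kernel f u n w"
    by (cases n) (simp_all add: bins_kernel_def)
  have eP: "emeasure (bins.eP f u n x) {restrict w {0..<Suc n}} =
      emeasure (bins_kernel f u n w) {w n} * indicator {restrict w {0..<n}} x"
    if x: "x \<in> space (?M n)" for x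
  proof -
    have "emeasure (bins.eP f u n x) {restrict w {0..<Suc n}} =
        emeasure (bins_kernel f u n x) {z. x(n := z) = restrict w {0..<Suc n}}"
      using bins.emeasure_eP[OF x sing, of f u] by (simp add: vimage_def)
    also have "\<dots> = emeasure (bins_kernel f u n w) {w n} * indicator {restrict w {0..<n}} x"
    proof (cases "x = restrict w {0..<n}")
      case True
      have "{z. x(n := z) = restrict w {0..<Suc n}} = {w n}"
        by (auto simp: True fun_eq_iff restrict_def less_Suc_eq)
      then show ?thesis
        using kernel True by simp
    next
      case False
      have "x(n := z) \<noteq> restrict w {0..<Suc n}" for z
      proof
        assume *: "x(n := z) = restrict w {0..<Suc n}"
        have "x i = restrict w {0..<n} i" for i
          using fun_cong[OF *, of i] x
          by (cases "i < n"; cases "i = n") (auto simp: space_PiM PiE_iff extensional_def)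
        with False show False
          by auto
      qed
      with False show ?thesis
        by simp
    qed
    finally show ?thesis .
  qed
  have "emeasure (bins.C f u 0 (Suc n) (\<lambda>_. undefined)) {restrict w {0..<Suc n}} =
      (\<integral>\<^sup>+x. emeasure (bins.eP f u n x) {restrict w {0..<Suc n}} \<partial>?C)"
    unfolding bins.C.simps add_0
  proof (rule emeasure_bind[where N = "?M (Suc n)"])
    show "space ?C \<noteq> {}"
      unfolding space_C by (simp add: space_PiM_empty_iff)
    show "bins.eP f u n \<in> measurable ?C (subprob_algebra (?M (Suc n)))"
      using bins.measurable_eP[of f u n] bins.sets_C[of "\<lambda>_. undefined" 0 f u n]
      by (subst measurable_cong_sets[OF _ refl]) auto
  qed (rule sing)
  also have "\<dots> = (\<integral>\<^sup>+x. emeasure (bins_kernel f u n w) {w n} *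
      indicator {restrict w {0..<n}} x \<partial>?C)"
    by (intro nn_integral_cong) (simp add: eP space_C)
  also have "\<dots> = emeasure (bins_kernel f u n w) {w n} * emeasure ?C {restrict w {0..<n}}"
    using sing[of n] bins.sets_C[of "\<lambda>_. undefined" 0 f u n]
    by (intro nn_integral_cmult_indicator) simp
  finally show ?case
    unfolding Suc.IH prod.lessThan_Suc by (simp only: mult.commute)
qed

theorem bins_measure_cylinder:
  "emeasure (bins_measure f u) {\<omega>. \<forall>i\<le>m. \<omega> i = w i} =
     ennreal (if w 0 = u then \<Prod>i<m. pmf (bins_step f (w i)) (w (Suc i)) else 0)"
proof -
  let ?N = "\<lambda>_. count_space (UNIV :: (nat \<times> nat) set)"
  have "{\<omega>. \<forall>i\<le>m. \<omega> i = w i} = prod_emb UNIV ?N {0..<Suc m} {restrict w {0..<Suc m}}"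
    by (auto simp: prod_emb_def fun_eq_iff restrict_def less_Suc_eq_le split: if_splits)
  moreover have "{restrict w {0..<Suc m}} \<in> sets (PiM {0..<Suc m} ?N)"
  proof -
    have "{restrict w {0..<Suc m}} = PiE {0..<Suc m} (\<lambda>i. {restrict w {0..<Suc m} i})"
      by (rule PiE_singleton[symmetric]) simp
    also have "\<dots> \<in> sets (PiM {0..<Suc m} ?N)"
      by (rule sets_PiM_I_finite) auto
    finally show ?thesis .
  qed
  ultimately have "emeasure (bins_measure f u) {\<omega>. \<forall>i\<le>m. \<omega> i = w i} =
      (\<Prod>i<Suc m. emeasure (bins_kernel f u i w) {w i})"
    by (simp only: emeasure_bins_measure emeasure_bins_C)
  also have "\<dots> = ennreal (pmf (return_pmf u) (w 0)) *
      (\<Prod>i<m. ennreal (pmf (bins_step f (w i)) (w (Suc i))))"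
    unfolding prod.lessThan_Suc_shift by (simp add: bins_kernel_def emeasure_pmf_single)
  finally show ?thesis
    by (auto simp: prod_ennreal)
qed

end

theory Submission
  imports Defs "HOL-Real_Asymp.Real_Asymp"
begin

text \<open>
  Put \<open>A i = f (x + i)\<close> and \<open>B j = f (y + j)\<close>, and divide the probability that the chain visits
  \<open>(x + i, y + j)\<close> by \<open>1 / A i + 1 / B j\<close>. The resulting weights \<open>w i j\<close> satisfy
  \<open>w i j = (A i * w (i - 1) j + B j * w i (j - 1)) / (A i + B j)\<close>, an averaging recursion. Hence they
  are bounded below by their infimum on the boundary, which is positive. The differences
  \<open>A i * (w i j - w (i - 1) j)\<close> satisfy the same recursion and so are bounded; as the reciprocals of
  \<open>A\<close> and \<open>B\<close> are summable, \<open>w i j\<close> tends to some \<open>W i\<close> as \<open>j \<longrightarrow> \<infinity>\<close>, and \<open>W i\<close> to a limit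
  \<open>w\<^sub>1 > 0\<close>. The first bin ends with exactly \<open>x + i\<close> balls with probability \<open>W i / A i\<close>. Summing over
  \<open>x + i > n\<close>, and doing the same for the second bin, gives the tail \<open>(w\<^sub>1 + w\<^sub>2) * S1 f n\<close>
  asymptotically.

  The asymptotics of \<open>S1\<close> come from telescoping \<open>t / g t\<close>, whose derivative is
  \<open>- (h t - 1) / g t\<close>, over a window on which \<open>h\<close> is almost constant.
\<close>

section \<open>The averaging recursion\<close>

text \<open>In the continuous-time embedding of the process into independent exponential waiting times
  with rates \<open>A\<close> and \<open>B\<close>, \<open>meet A B i j\<close> is the density at 0 of the difference of the sums of the
  first \<open>i + 1\<close> waiting times of one bin and the first \<open>j + 1\<close> of the other.\<close>
fun meet :: "(nat \<Rightarrow> real) \<Rightarrow> (nat \<Rightarrow> real) \<Rightarrow> nat \<Rightarrow> nat \<Rightarrow> real" where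
  "meet A B 0 0 = A 0 * B 0 / (A 0 + B 0)"
| "meet A B (Suc i) 0 = A (Suc i) * meet A B i 0 / (A (Suc i) + B 0)"
| "meet A B 0 (Suc j) = B (Suc j) * meet A B 0 j / (A 0 + B (Suc j))"
| "meet A B (Suc i) (Suc j) =
     (A (Suc i) * meet A B i (Suc j) + B (Suc j) * meet A B (Suc i) j) / (A (Suc i) + B (Suc j))"

declare meet.simps [simp del]

text \<open>Exchanging the two bins transposes the weights, so estimates along the first index carry
  over to the second.\<close>

lemma meet_commute: "meet A B i j = meet B A j i"
  by (induction A B i j rule: meet.induct) (simp_all add: meet.simps add.commute mult.commute)

text \<open>The quotient is a convex combination of \<open>d\<close> and \<open>- e\<close>, with
  weights \<open>b / (a + b)\<close> and \<open>a / (a + b)\<close>.\<close>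

lemma abs_weighted_diff_le:
  assumes "a > 0" "b > 0" "\<bar>d\<bar> \<le> K" "\<bar>e\<bar> \<le> (K::real)"
  shows "\<bar>(b * d - a * e) / (a + b)\<bar> \<le> K"
proof -
  have "\<bar>b * d - a * e\<bar> \<le> b * \<bar>d\<bar> + a * \<bar>e\<bar>"
    using assms abs_triangle_ineq4[of "b * d" "a * e"] by (simp add: abs_mult)
  also have "\<dots> \<le> b * K + a * K"
    using assms by (intro add_mono mult_left_mono) auto
  finally show ?thesis
    using assms by (simp add: field_simps)
qed

locale meeting =
  fixes A B :: "nat \<Rightarrow> real"
  assumes A_pos: "A i > 0" and B_pos: "B j > 0"
begin

lemma sum_pos [simp]: "A i + B j > 0" and sum_neq_0 [simp]: "A i + B j \<noteq> 0"
  using A_pos[of i] B_pos[of j] by simp_all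

lemma meet_pos: "meet A B i j > 0"
proof (induction "i + j" arbitrary: i j rule: less_induct)
  case less
  show ?case
    using A_pos B_pos less
    by (cases i; cases j) (auto simp: meet.simps intro!: divide_pos_pos add_pos_pos mult_pos_pos)
qed

lemma meet_Suc_Suc:
  "(A (Suc i) + B (Suc j)) * meet A B (Suc i) (Suc j) =
     A (Suc i) * meet A B i (Suc j) + B (Suc j) * meet A B (Suc i) j"
  by (simp add: meet.simps)

text \<open>The two weighted differences entering the same lattice point are opposite, so a bound on
  one is a bound on the other.\<close>

lemma meet_diff_eq:
  "B (Suc j) * (meet A B (Suc i) (Suc j) - meet A B (Suc i) j) =
   - (A (Suc i) * (meet A B (Suc i) (Suc j) - meet A B i (Suc j)))"
  using meet_Suc_Suc[of i j] by (simp add: algebra_simps)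

text \<open>The weighted first differences satisfy the same averaging recursion as the weights, so they
  are controlled by their boundary values.\<close>
lemma meet_diff_rec:
  "A (Suc i) * (meet A B (Suc i) (Suc j) - meet A B i (Suc j)) =
     (B (Suc j) * (A (Suc i) * (meet A B (Suc i) j - meet A B i j)) -
      A (Suc i) * (B (Suc j) * (meet A B i (Suc j) - meet A B i j))) / (A (Suc i) + B (Suc j))"
proof -
  \<comment> \<open>Here \<open>p\<close>, \<open>q\<close>, \<open>r\<close> stand for the weights
    at \<open>(i, j + 1)\<close>, \<open>(i + 1, j)\<close> and \<open>(i, j)\<close>. On the right
    \<open>r\<close> cancels; it serves to write \<open>q - p\<close> through the two differences
    leaving \<open>(i, j)\<close>.\<close>
  have "a * (((a * p + b * q) / (a + b)) - p) = (b * (a * (q - r)) - a * (b * (p - r))) / (a + b)"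
    if "a + b \<noteq> 0" for a b p q r :: real
    using that by (simp add: field_simps)
  from this[OF sum_neq_0] show ?thesis
    unfolding meet.simps(4) .
qed

lemma meet_fst_le: "meet A B i 0 \<le> meet A B 0 0"
proof (induction i)
  case (Suc i)
  have "A (Suc i) * meet A B i 0 / (A (Suc i) + B 0) \<le> meet A B i 0"
    using A_pos[of "Suc i"] B_pos[of 0] meet_pos[of i 0] by (simp add: field_simps)
  then show ?case using Suc by (simp add: meet.simps)
qed simp

text \<open>On the edge \<open>j = 0\<close> a step multiplies the weight by
  \<open>A (Suc i) / (A (Suc i) + B 0)\<close>, so the weighted difference is at most
  \<open>B 0\<close> times a weight, and weights decrease along the edge.\<close>

lemma meet_diff_boundary: "\<bar>A (Suc i) * (meet A B (Suc i) 0 - meet A B i 0)\<bar> \<le> A 0 * B 0"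
proof -
  have "A (Suc i) * (meet A B (Suc i) 0 - meet A B i 0) =
      - (A (Suc i) / (A (Suc i) + B 0) * (B 0 * meet A B i 0))"
    using sum_neq_0[of "Suc i" 0] by (simp add: meet.simps field_simps)
  also have "\<bar>\<dots>\<bar> \<le> 1 * (B 0 * meet A B i 0)"
    using A_pos[of "Suc i"] B_pos[of 0] meet_pos[of i 0]
    by (simp add: abs_mult pos_divide_le_eq)
  also have "\<dots> \<le> B 0 * meet A B 0 0"
    using meet_fst_le[of i] B_pos[of 0] by simp
  also have "\<dots> \<le> A 0 * B 0"
    using A_pos[of 0] B_pos[of 0] by (simp add: meet.simps field_simps)
  finally show ?thesis .
qed

lemma meeting_swap: "meeting B A"
  by unfold_locales (rule A_pos B_pos)+

text \<open>Both bounds are proved in one induction because the recursion expresses a difference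
  through both kinds of difference at the preceding point; the edges are the base case.\<close>

lemma meet_diff_bound:
  "\<bar>A (Suc i) * (meet A B (Suc i) j - meet A B i j)\<bar> \<le> A 0 * B 0 \<and>
   \<bar>B (Suc j) * (meet A B i (Suc j) - meet A B i j)\<bar> \<le> A 0 * B 0"
proof (induction "i + j" arbitrary: i j rule: less_induct)
  case less
  interpret swap: meeting B A by (rule meeting_swap)
  have "\<bar>A (Suc i) * (meet A B (Suc i) j - meet A B i j)\<bar> \<le> A 0 * B 0"
  proof (cases j)
    case 0
    then show ?thesis using meet_diff_boundary by simp
  next
    case (Suc k)
    then show ?thesis
      unfolding Suc meet_diff_rec using less[of i k] A_pos B_pos Suc
      by (intro abs_weighted_diff_le) auto
  qed
  moreover have "\<bar>B (Suc j) * (meet A B i (Suc j) - meet A B i j)\<bar> \<le> A 0 * B 0"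
  proof (cases i)
    case 0
    then show ?thesis
      using swap.meet_diff_boundary[of j] by (simp add: meet_commute[of A B] mult.commute)
  next
    case (Suc k)
    have "\<bar>A (Suc k) * (meet A B (Suc k) (Suc j) - meet A B k (Suc j))\<bar> \<le> A 0 * B 0"
      unfolding meet_diff_rec using less[of k j] A_pos B_pos Suc
      by (intro abs_weighted_diff_le) auto
    then show ?thesis
      unfolding Suc meet_diff_eq by simp
  qed
  ultimately show ?case ..
qed

lemma meet_fst_diff: "\<bar>meet A B (Suc i) j - meet A B i j\<bar> \<le> A 0 * B 0 / A (Suc i)"
  using meet_diff_bound[of i j] A_pos[of "Suc i"] by (simp add: abs_mult pos_le_divide_eq mult.commute)

lemma meet_snd_diff: "\<bar>meet A B i (Suc j) - meet A B i j\<bar> \<le> A 0 * B 0 / B (Suc j)"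
  using meet_diff_bound[of i j] B_pos[of "Suc j"] by (simp add: abs_mult pos_le_divide_eq mult.commute)

end

section \<open>Limits of the weights when the reciprocals are summable\<close>

lemma convergent_if_summable_diff_bound:
  fixes u :: "nat \<Rightarrow> real"
  assumes "\<And>n. \<bar>u (Suc n) - u n\<bar> \<le> K / v (Suc n)" "summable (\<lambda>n. 1 / v n)"
  shows "convergent u"
proof -
  have "summable (\<lambda>n. K * (1 / v (Suc n)))"
    using assms(2) by (intro summable_mult) (subst summable_Suc_iff)
  then have "summable (\<lambda>n. u (Suc n) - u n)"
    by (rule summable_comparison_test') (use assms(1) in simp)
  then have "convergent (\<lambda>n. u n - u 0)"
    by (simp only: summable_iff_convergent sum_lessThan_telescope)
  then show ?thesis
    by (simp only: convergent_diff_const_right_iff)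
qed

locale transient_meeting = meeting +
  assumes A_summable: "summable (\<lambda>i. 1 / A i)" and B_summable: "summable (\<lambda>j. 1 / B j)"
begin

text \<open>This is \<open>W i\<close> of the overview; that the limit exists is the next
  lemma.\<close>

definition meet_lim :: "nat \<Rightarrow> real" where
  "meet_lim i = lim (meet A B i)"

lemma meet_lim: "meet A B i \<longlonglongrightarrow> meet_lim i"
  unfolding meet_lim_def convergent_LIMSEQ_iff[symmetric]
  using meet_snd_diff B_summable by (rule convergent_if_summable_diff_bound)

text \<open>The bound on the difference of neighbouring rows is uniform in the second index, hence
  survives the passage to the limit.\<close>

lemma convergent_meet_lim: "convergent meet_lim"
proof (rule convergent_if_summable_diff_bound[OF _ A_summable])
  show "\<bar>meet_lim (Suc i) - meet_lim i\<bar> \<le> A 0 * B 0 / A (Suc i)" for i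
    by (rule LIMSEQ_le_const2[OF tendsto_rabs[OF tendsto_diff[OF meet_lim meet_lim]]])
      (use meet_fst_diff in blast)
qed

text \<open>On the edge the weight is \<open>meet A B 0 0\<close> times a product of factors
  \<open>1 / (1 + B 0 / A k)\<close>, each at least \<open>exp (- B 0 / A k)\<close>.\<close>

lemma meet_fst_ge: "meet A B i 0 \<ge> meet A B 0 0 * exp (- B 0 * (\<Sum>k. 1 / A k))"
proof -
  \<comment> \<open>The product starts at \<open>k = 1\<close>; including \<open>k = 0\<close> in
    the sum only lowers the bound.\<close>
  have "meet A B i 0 \<ge> meet A B 0 0 * exp (- B 0 * (\<Sum>k<Suc i. 1 / A k))"
  proof (induction i)
    case 0
    show ?case using A_pos[of 0] B_pos[of 0] meet_pos[of 0 0] by simp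
  next
    case (Suc i)
    have "1 + B 0 / A (Suc i) \<le> exp (B 0 / A (Suc i))"
      by (rule exp_ge_add_one_self)
    then have "exp (- (B 0 / A (Suc i))) \<le> inverse (1 + B 0 / A (Suc i))"
      using A_pos[of "Suc i"] B_pos[of 0] unfolding exp_minus
      by (intro le_imp_inverse_le add_pos_pos divide_pos_pos) auto
    also have "\<dots> = A (Suc i) / (A (Suc i) + B 0)"
      using A_pos[of "Suc i"] by (simp add: divide_simps)
    finally have "meet A B i 0 * exp (- (B 0 / A (Suc i))) \<le>
        meet A B i 0 * (A (Suc i) / (A (Suc i) + B 0))"
      using meet_pos[of i 0] by (intro mult_left_mono) auto
    then have "meet A B i 0 * exp (- (B 0 / A (Suc i))) \<le> meet A B (Suc i) 0"
      by (simp add: meet.simps mult.commute)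
    moreover have "meet A B 0 0 * exp (- B 0 * (\<Sum>k<Suc (Suc i). 1 / A k)) =
        meet A B 0 0 * exp (- B 0 * (\<Sum>k<Suc i. 1 / A k)) * exp (- (B 0 / A (Suc i)))"
      by (simp only: sum.lessThan_Suc[of _ "Suc i"] distrib_left exp_add) simp
    moreover have "meet A B 0 0 * exp (- B 0 * (\<Sum>k<Suc i. 1 / A k)) * exp (- (B 0 / A (Suc i)))
        \<le> meet A B i 0 * exp (- (B 0 / A (Suc i)))"
      by (rule mult_right_mono[OF Suc]) simp
    ultimately show ?case by linarith
  qed
  moreover have "(\<Sum>k<Suc i. 1 / A k) \<le> (\<Sum>k. 1 / A k)"
    using A_summable A_pos by (intro sum_le_suminf) (auto intro: less_imp_le)
  then have "meet A B 0 0 * exp (- B 0 * (\<Sum>k<Suc i. 1 / A k)) \<ge>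
      meet A B 0 0 * exp (- B 0 * (\<Sum>k. 1 / A k))"
    using B_pos[of 0] meet_pos[of 0 0] by simp
  ultimately show ?thesis by linarith
qed

lemma transient_meeting_swap: "transient_meeting B A"
  by unfold_locales (rule A_pos B_pos A_summable B_summable)+

text \<open>A minimum principle: an interior weight is a convex combination of two earlier ones, so
  a lower bound on both edges spreads to the whole quadrant.\<close>

lemma meet_ge:
  obtains d where "d > 0" "\<And>i j. meet A B i j \<ge> d"
proof -
  interpret swap: transient_meeting B A by (rule transient_meeting_swap)
  define d where "d = min (meet A B 0 0 * exp (- B 0 * (\<Sum>k. 1 / A k)))
    (meet A B 0 0 * exp (- A 0 * (\<Sum>k. 1 / B k)))"
  have "d > 0"
    using meet_pos[of 0 0] by (simp add: d_def)
  moreover have "meet A B i j \<ge> d" for i j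
  proof (induction "i + j" arbitrary: i j rule: less_induct)
    case less
    have 0: "meet A B i 0 \<ge> d" "meet A B 0 j \<ge> d" for i j
      using meet_fst_ge[of i] swap.meet_fst_ge[of j]
      by (simp_all add: d_def meet_commute[of B A])
    show ?case
    proof (cases i; cases j)
      fix k l assume kl: "i = Suc k" "j = Suc l"
      have "d * (A i + B j) = A i * d + B j * d" by (simp add: algebra_simps)
      also have "\<dots> \<le> A i * meet A B k j + B j * meet A B i l"
        using less[of k j] less[of i l] kl A_pos B_pos
        by (intro add_mono mult_left_mono) (auto intro: less_imp_le)
      finally show ?thesis
        using kl by (simp add: meet.simps pos_le_divide_eq)
    qed (use 0 in auto)
  qed
  ultimately show ?thesis by (rule that)
qed

lemma meet_lim_tendsto_pos: obtains c where "c > 0" "meet_lim \<longlonglongrightarrow> c"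
proof -
  obtain d where d: "d > 0" "\<And>i j. meet A B i j \<ge> d"
    using meet_ge by blast
  obtain c where c: "meet_lim \<longlonglongrightarrow> c"
    using convergent_meet_lim by (auto simp: convergent_def)
  have "meet_lim i \<ge> d" for i
    using d by (intro LIMSEQ_le_const[OF meet_lim]) auto
  then have "c \<ge> d"
    by (intro LIMSEQ_le_const[OF c]) auto
  with d c that[of c] show ?thesis by simp
qed

end

section \<open>Tails of the series of reciprocals\<close>

locale feedback_extension =
  fixes f :: "nat \<Rightarrow> real" and g :: "real \<Rightarrow> real"
  assumes ext: "valid_extension f g"
begin

abbreviation h :: "real \<Rightarrow> real" where "h \<equiv> char_exponent g"

lemma g_eq: "n \<ge> 1 \<Longrightarrow> g (real n) = f n"
  and g_pos: "x \<ge> 1 \<Longrightarrow> g x > 0"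
  using ext by (auto simp: valid_extension_def C1_extension_def)

lemma f_pos: "n \<ge> 1 \<Longrightarrow> f n > 0"
  using g_eq[of n] g_pos[of "real n"] by simp

text \<open>Since \<open>h\<close> is \<open>x\<close> times the logarithmic derivative,
  \<open>g' = g h / x\<close>. For \<open>x > 1\<close> the derivative within the half-line is the
  ordinary one.\<close>

lemma DERIV_g:
  assumes "x > 1"
  shows "(g has_real_derivative g x * h x / x) (at x)"
proof -
  obtain g' where g': "\<And>x. x \<ge> 1 \<Longrightarrow> (g has_real_derivative g' x) (at x within {1..})"
    using ext by (auto simp: valid_extension_def C1_extension_def)
  have at: "at x within {1..} = at x"
    using assms by (intro at_within_interior) simp
  have g'x: "(g has_real_derivative g' x) (at x)"
    using g'[of x] assms at by simp
  have "((\<lambda>t. ln (g t)) has_real_derivative g' x / g x) (at x)"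
    using g_pos[of x] assms by (auto intro!: derivative_eq_intros g'x)
  then have "h x = x * (g' x / g x)"
    unfolding char_exponent_def at has_real_derivative_iff_has_vector_derivative
    by (simp add: vector_derivative_at)
  then have "g x * h x / x = g' x"
    using g_pos[of x] assms by simp
  with g'x show ?thesis by simp
qed

lemma DERIV_divide_g:
  assumes "x > 1"
  shows "((\<lambda>t. t / g t) has_real_derivative (1 - h x) / g x) (at x)"
  using g_pos[of x] assms
  by (auto intro!: derivative_eq_intros DERIV_g simp: field_simps)

lemma h_ge:
  obtains d x1 where "d > 0" "x1 > 1" "\<And>x. x \<ge> x1 \<Longrightarrow> h x \<ge> 1 + d"
proof -
  have "1 < Liminf at_top (\<lambda>x. ereal (h x))"
    using ext by (simp add: valid_extension_def valid_exponent_def)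
  then obtain r where r: "1 < r" "r < Liminf at_top (\<lambda>x. ereal (h x))"
    using dense by blast
  \<comment> \<open>The liminf may be infinite, so a real number \<open>b\<close> is inserted
    between 1 and it.\<close>
  then obtain b where b: "ereal b < r" "1 < ereal b"
    using ereal_dense2[of 1 r] by auto
  have "eventually (\<lambda>x. ereal (h x) > ereal b) at_top"
    using b r by (intro less_LiminfD) auto
  then obtain x0 where x0: "\<And>x. x \<ge> x0 \<Longrightarrow> b < h x"
    by (auto simp: eventually_at_top_linorder)
  show ?thesis
    using b x0 by (intro that[of "b - 1" "max x0 2"]) (auto intro: less_imp_le)
qed

section \<open>Comparison of sums of reciprocals with increments of \<open>t / g t\<close>\<close>

lemma g_mono:
  assumes "a > 1" "a \<le> b" "\<And>t. a \<le> t \<Longrightarrow> t \<le> b \<Longrightarrow> h t \<ge> 0"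
  shows "g a \<le> g b"
proof (rule DERIV_nonneg_imp_nondecreasing[OF \<open>a \<le> b\<close>])
  fix t assume "a \<le> t" "t \<le> b"
  then show "\<exists>y. (g has_real_derivative y) (at t) \<and> 0 \<le> y"
    using assms g_pos[of t]
    by (intro exI[of _ "g t * h t / t"]) (auto intro!: DERIV_g divide_nonneg_pos mult_nonneg_nonneg)
qed

text \<open>The mean value theorem for \<open>t / g t\<close> on \<open>[n, n + 1]\<close>.
  Monotonicity of \<open>g\<close> there places \<open>1 / g z\<close> between the two neighbouring
  reciprocals, one for each direction of the sum estimates.\<close>

lemma divide_g_step:
  assumes "n > 1" "\<And>t. real n \<le> t \<Longrightarrow> t \<le> real (Suc n) \<Longrightarrow> h t \<ge> 0"
  obtains z where "real n < z" "z < real (Suc n)"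
    "real n / f n - real (Suc n) / f (Suc n) = (h z - 1) * (1 / g z)"
    "1 / f (Suc n) \<le> 1 / g z" "1 / g z \<le> 1 / f n"
proof -
  have "\<exists>z>real n. z < real (Suc n) \<and> real (Suc n) / g (real (Suc n)) - real n / g (real n) =
      (real (Suc n) - real n) * ((1 - h z) / g z)"
    using assms(1) by (intro MVT2 DERIV_divide_g) auto
  then obtain z where z: "real n < z" "z < real (Suc n)"
    and eq: "real (Suc n) / f (Suc n) - real n / f n = (1 - h z) / g z"
    using assms(1) g_eq[of n] g_eq[of "Suc n"] by auto
  have "g (real n) \<le> g z"
    using z assms by (intro g_mono) auto
  moreover have "g z \<le> g (real (Suc n))"
    using z assms by (intro g_mono) auto
  ultimately have "f n \<le> g z" "g z \<le> f (Suc n)"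
    using assms(1) by (simp_all add: g_eq del: of_nat_Suc)
  moreover have "f n > 0" "g z > 0" "f (Suc n) > 0"
    using assms(1) z f_pos[of n] f_pos[of "Suc n"] g_pos[of z] by auto
  ultimately show ?thesis
    using eq by (intro that[OF z]) (auto simp: frac_le diff_divide_distrib left_diff_distrib)
qed

lemma sum_divide_f_telescope:
  assumes "n \<le> N"
  shows "(\<Sum>j=n..<N. real j / f j - real (Suc j) / f (Suc j)) = real n / f n - real N / f N"
  using sum_Suc_diff'[OF assms, of "\<lambda>j. real j / f j"] by (simp only: sum_subtractf)

lemma sum_upper_bound:
  assumes "n > 1" "n \<le> N" "m \<ge> 0" "\<And>t. real n \<le> t \<Longrightarrow> t \<le> real N \<Longrightarrow> m \<le> h t - 1"
  shows "m * (\<Sum>j=n..<N. 1 / f (Suc j)) \<le> real n / f n - real N / f N"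
  unfolding sum_divide_f_telescope[OF \<open>n \<le> N\<close>, symmetric] sum_distrib_left
proof (rule sum_mono)
  fix j assume j: "j \<in> {n..<N}"
  have h: "m \<le> h t - 1" if "real j \<le> t" "t \<le> real (Suc j)" for t
    using assms j that by auto
  have "h t \<ge> 0" if "real j \<le> t" "t \<le> real (Suc j)" for t
    using h[OF that] assms(3) by simp
  then obtain z where z: "real j < z" "z < real (Suc j)"
      "real j / f j - real (Suc j) / f (Suc j) = (h z - 1) * (1 / g z)"
      "1 / f (Suc j) \<le> 1 / g z"
    using j assms(1) by (elim divide_g_step[rotated]) auto
  show "m * (1 / f (Suc j)) \<le> real j / f j - real (Suc j) / f (Suc j)"
    unfolding z(3) using z h[of z] assms(3) f_pos[of "Suc j"]
    by (intro mult_mono) auto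
qed

lemma sum_lower_bound:
  assumes "n > 1" "n \<le> N"
    and "\<And>t. real n \<le> t \<Longrightarrow> t \<le> real N \<Longrightarrow> 0 \<le> h t - 1 \<and> h t - 1 \<le> M"
  shows "real n / f n - real N / f N \<le> M * (\<Sum>j=n..<N. 1 / f j)"
  unfolding sum_divide_f_telescope[OF \<open>n \<le> N\<close>, symmetric] sum_distrib_left
proof (rule sum_mono)
  fix j assume j: "j \<in> {n..<N}"
  have h: "0 \<le> h t - 1 \<and> h t - 1 \<le> M" if "real j \<le> t" "t \<le> real (Suc j)" for t
    using assms j that by auto
  have "h t \<ge> 0" if "real j \<le> t" "t \<le> real (Suc j)" for t
    using h[OF that] by simp
  then obtain z where z: "real j < z" "z < real (Suc j)"
      "real j / f j - real (Suc j) / f (Suc j) = (h z - 1) * (1 / g z)"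
      "1 / g z \<le> 1 / f j"
    using j assms(1) by (elim divide_g_step[rotated]) auto
  show "real j / f j - real (Suc j) / f (Suc j) \<le> M * (1 / f j)"
    unfolding z(3) using z h[of z] g_pos[of z] assms(1) j
    by (intro mult_mono) auto
qed

text \<open>With \<open>h - 1\<close> bounded below by \<open>d\<close> on the whole half-line, the
  telescoped sums stay below \<open>n / f n\<close>, which gives summability and the size of the
  tail at once.\<close>

lemma tail_bound:
  assumes "n > 1" "d > 0" "\<And>t. t \<ge> real n \<Longrightarrow> h t \<ge> 1 + d"
  shows "summable (\<lambda>j. 1 / f (Suc n + j))" and "S1 f (Suc n) \<le> real n / f n / d"
proof -
  have bound: "(\<Sum>j<k. 1 / f (Suc n + j)) \<le> real n / f n / d" for k
  proof -
    have "d * (\<Sum>j=n..<n+k. 1 / f (Suc j)) \<le> real n / f n - real (n+k) / f (n+k)"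
      using assms by (intro sum_upper_bound) (auto simp: le_diff_eq add.commute)
    also have "\<dots> \<le> real n / f n"
      using f_pos[of "n+k"] assms(1) by simp
    also have "(\<Sum>j=n..<n+k. 1 / f (Suc j)) = (\<Sum>j<k. 1 / f (Suc n + j))"
      by (rule sum.reindex_bij_witness[of _ "\<lambda>j. n + j" "\<lambda>j. j - n"]) auto
    finally show ?thesis
      using assms(2) by (simp add: pos_le_divide_eq mult.commute del: divide_divide_eq_left)
  qed
  show "summable (\<lambda>j. 1 / f (Suc n + j))"
    using bound f_pos by (intro summableI_nonneg_bounded) (auto intro: less_imp_le)
  then show "S1 f (Suc n) \<le> real n / f n / d"
    unfolding S1_def by (intro suminf_le_const bound)
qed

text \<open>Summability far out suffices, as finitely many terms, among them possibly
  \<open>1 / f 0\<close>, do not affect it.\<close>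

lemma summable_inverse_f: "summable (\<lambda>j. 1 / f (n + j))"
proof -
  obtain d x1 where d: "d > 0" "x1 > 1" "\<And>x. x \<ge> x1 \<Longrightarrow> h x \<ge> 1 + d"
    by (rule h_ge) blast
  define N where "N = nat \<lceil>x1\<rceil>"
  have N: "real N \<ge> x1"
    unfolding N_def by linarith
  have "summable (\<lambda>j. 1 / f (Suc N + j))"
    using N d by (intro tail_bound(1)) auto
  then have "summable (\<lambda>j. 1 / f j)"
    by (subst (asm) add.commute) (simp only: summable_iff_shift[of "\<lambda>j. 1 / f j"])
  then show ?thesis
    by (subst add.commute) (simp only: summable_iff_shift[of "\<lambda>j. 1 / f j"])
qed

text \<open>The function \<open>ln (t / g t) + m * ln t\<close> has derivative
  \<open>(1 - h t + m) / t\<close>, which is nonpositive; so \<open>t / g t\<close> decays at least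
  like the power \<open>- m\<close> of \<open>t\<close>.\<close>

lemma divide_g_decay:
  assumes "1 < a" "a \<le> b" "\<And>t. a \<le> t \<Longrightarrow> t \<le> b \<Longrightarrow> m \<le> h t - 1"
  shows "b / g b \<le> a / g a * exp (- m * ln (b / a))"
proof -
  have "ln b - ln (g b) + m * ln b \<le> ln a - ln (g a) + m * ln a"
  proof (rule DERIV_nonpos_imp_nonincreasing[OF \<open>a \<le> b\<close>])
    fix t assume t: "a \<le> t" "t \<le> b"
    have "((\<lambda>t. ln t - ln (g t) + m * ln t) has_real_derivative (1 - h t + m) / t) (at t)"
      using t assms(1) g_pos[of t]
      by (auto intro!: derivative_eq_intros DERIV_g simp: field_simps)
    moreover have "(1 - h t + m) / t \<le> 0"
      using t assms by (intro divide_nonpos_pos) (auto simp: algebra_simps)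
    ultimately show "\<exists>y. ((\<lambda>t. ln t - ln (g t) + m * ln t) has_real_derivative y) (at t) \<and> y \<le> 0"
      by blast
  qed
  then have "ln (b / g b) \<le> ln (a / g a) + (- m * ln (b / a))"
    using assms(1,2) g_pos[of a] g_pos[of b] by (simp add: ln_div algebra_simps)
  then have "exp (ln (b / g b)) \<le> exp (ln (a / g a) + (- m * ln (b / a)))"
    by simp
  then show ?thesis
    unfolding exp_add using assms(1,2) g_pos[of a] g_pos[of b] by (simp del: exp_le_cancel_iff)
qed

section \<open>Sharp asymptotics of \<open>S1\<close>\<close>

lemma exponent_variation:
  obtains C x0 where "C > 0" "x0 \<ge> 1"
    "\<And>e x t. 0 < e \<Longrightarrow> e < 1 \<Longrightarrow> x \<ge> x0 \<Longrightarrow> x \<le> t \<Longrightarrow> t \<le> x powr (1 + e) \<Longrightarrow>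
      \<bar>h t / h x - 1\<bar> \<le> C * e"
proof -
  obtain C x0 where C: "C > 0" "x0 \<ge> 1" and sup: "\<forall>\<epsilon>\<in>{0<..<1}. \<forall>x\<ge>x0.
        (SUP t\<in>{x..x powr (1 + \<epsilon>)}. ereal \<bar>h t / h x - 1\<bar>) \<le> ereal (C * \<epsilon>)"
    using ext by (auto simp: valid_extension_def valid_exponent_def)
  show ?thesis
  proof (rule that[OF C])
    fix e x t assume *: "0 < e" "e < 1" "x \<ge> x0" "x \<le> t" "t \<le> x powr (1 + e)"
    have "ereal \<bar>h t / h x - 1\<bar> \<le> (SUP t\<in>{x..x powr (1 + e)}. ereal \<bar>h t / h x - 1\<bar>)"
      using * by (intro SUP_upper) auto
    also have "\<dots> \<le> ereal (C * e)"
      using sup * by auto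
    finally show "\<bar>h t / h x - 1\<bar> \<le> C * e" by simp
  qed
qed

text \<open>Growth of \<open>h\<close> below the power 1/4 is more than enough. The limit makes the
  single term \<open>1 / f n\<close> negligible against \<open>S1 f n\<close>.\<close>

lemma h_over_n_tendsto: "(\<lambda>n. (h (real n) - 1) / real n) \<longlonglongrightarrow> 0"
proof -
  have "((\<lambda>x. x powr (-1/4) * h x) \<longlongrightarrow> 0) at_top"
    using ext by (simp add: valid_extension_def valid_exponent_def)
  then have "(\<lambda>n. real n powr (-1/4) * h (real n)) \<longlonglongrightarrow> 0"
    by (rule filterlim_compose[OF _ filterlim_real_sequentially])
  moreover have "(\<lambda>n. real n powr (-3/4)) \<longlonglongrightarrow> 0"
    by real_asymp
  ultimately have "(\<lambda>n. (real n powr (-1/4) * h (real n)) * real n powr (-3/4) - 1 / real n) \<longlonglongrightarrow> 0 * 0 - 0"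
    by (intro tendsto_intros lim_1_over_n)
  moreover have "eventually (\<lambda>n. (real n powr (-1/4) * h (real n)) * real n powr (-3/4) - 1 / real n =
      (h (real n) - 1) / real n) sequentially"
    using eventually_gt_at_top[of 0]
  proof eventually_elim
    case (elim n)
    have "real n powr (-1/4) * real n powr (-3/4) = 1 / real n"
      using elim by (simp add: powr_add[symmetric] powr_minus_divide)
    then show ?case
      by (simp add: diff_divide_distrib mult.commute mult.left_commute)
  qed
  ultimately show ?thesis
    by (simp add: filterlim_cong)
qed

text \<open>Over the window from \<open>n\<close> to about \<open>n * exp s\<close>, \<open>s = sqrt (ln n)\<close>, the exponent varies by a
  factor \<open>1 + O(1 / s)\<close>, while \<open>j / f j\<close> drops by a factor of order \<open>s * (h n - 1)\<close> at least.\<close>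
lemma S1_ratio_bounds:
  obtains K d where "K > 0" "d > 0"
    "\<forall>\<^sub>F n in sequentially.
      let s = sqrt (ln (real n)); H = h (real n) - 1; r = S1 f n * H / (real n / f n)
      in (1 - 1 / (d * (1 - K / s) * (s / 2))) / (1 + K / s) \<le> r \<and>
         r \<le> H / real n + 1 / (1 - K / s) + 1 / (d * (1 - K / s) * (s / 2))"
proof -
  obtain d x1 where d: "d > 0" "x1 > 1" "\<And>x. x \<ge> x1 \<Longrightarrow> h x \<ge> 1 + d"
    by (rule h_ge) blast
  obtain C x0 where C: "C > 0" "x0 \<ge> 1" and var:
    "\<And>e x t. 0 < e \<Longrightarrow> e < 1 \<Longrightarrow> x \<ge> x0 \<Longrightarrow> x \<le> t \<Longrightarrow> t \<le> x powr (1 + e) \<Longrightarrow>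
      \<bar>h t / h x - 1\<bar> \<le> C * e"
    by (rule exponent_variation) blast
  \<comment> \<open>The factor \<open>(1 + d) / d\<close> turns an error relative to
    \<open>h n\<close> into one relative to \<open>h n - 1\<close>, since
    \<open>h n \<ge> 1 + d\<close>.\<close>
  define K where "K = C * ((1 + d) / d)"
  have "K > 0" using C d by (simp add: K_def)
  show thesis
  proof (rule that[OF \<open>K > 0\<close> \<open>d > 0\<close>])
    have "\<forall>\<^sub>F n in sequentially. sqrt (ln (real n)) > max 2 K"
      by real_asymp
    moreover have "\<forall>\<^sub>F n in sequentially. real n \<ge> max x0 x1"
      by real_asymp
    ultimately show "\<forall>\<^sub>F n in sequentially.
      let s = sqrt (ln (real n)); H = h (real n) - 1; r = S1 f n * H / (real n / f n)
      in (1 - 1 / (d * (1 - K / s) * (s / 2))) / (1 + K / s) \<le> r \<and>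
         r \<le> H / real n + 1 / (1 - K / s) + 1 / (d * (1 - K / s) * (s / 2))"
    proof eventually_elim
      case (elim n)
      define s where "s = sqrt (ln (real n))"
      define H where "H = h (real n) - 1"
      define th where "th = K / s"
      \<comment> \<open>Rounding down to an integer makes the window end \<open>N\<close> a natural
        number with \<open>N / n = R\<close> exactly.\<close>
      define R where "R = nat \<lfloor>exp s\<rfloor>"
      define N where "N = R * n"
      define k where "k = real n / f n"
      have s: "s > 2" "s > K" and n: "real n \<ge> x0" "real n \<ge> x1" "n > 1"
        using elim d by (auto simp: s_def)
      have H: "H \<ge> d" using d(3)[of "real n"] n by (simp add: H_def)
      have th: "0 < th" "th < 1" using s \<open>K > 0\<close> by (auto simp: th_def)
      have k: "k > 0" using n f_pos[of n] by (simp add: k_def)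
      have exp_half: "exp (s/2) \<ge> 2" using exp_ge_add_one_self[of "s/2"] s by linarith
      \<comment> \<open>As \<open>exp (s / 2) \<ge> 2\<close>, the floor of \<open>exp s\<close> is
        at least \<open>2 * exp (s / 2) - 1\<close>, hence at least
        \<open>exp (s / 2)\<close>.\<close>
      have "exp s = exp (s/2) * exp (s/2)" by (simp add: exp_add[symmetric])
      moreover have "exp (s/2) * exp (s/2) \<ge> 2 * exp (s/2)"
        using exp_half by (intro mult_right_mono) auto
      ultimately have R: "real R \<le> exp s" "real R \<ge> exp (s / 2)"
        using exp_half unfolding R_def by linarith+
      have "R \<ge> 1" using R exp_half by linarith
      then have nN: "n \<le> N" by (simp add: N_def)
      \<comment> \<open>Since the square of \<open>s\<close> is \<open>ln n\<close>, the variation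
        condition with \<open>\<epsilon> = 1 / s\<close> covers exactly the range up to
        \<open>n * exp s\<close>.\<close>
      have "ln (real n) / s = s"
        using s n by (simp add: s_def real_div_sqrt)
      then have "real n powr (1 / s) = exp s"
        using n by (simp add: powr_def)
      then have "real n powr (1 + 1 / s) = real n * exp s"
        using n by (simp add: powr_add)
      then have N_le: "real N \<le> real n powr (1 + 1 / s)"
        using R n by (simp add: N_def mult.commute mult_right_mono)
      have h: "H * (1 - th) \<le> h t - 1 \<and> h t - 1 \<le> H * (1 + th)" if t: "real n \<le> t" "t \<le> real N" for t
      proof -
        have "\<bar>h t / h (real n) - 1\<bar> \<le> C * (1 / s)"
          using t N_le s n by (intro var) auto
        moreover have "h t / h (real n) - 1 = (h t - h (real n)) / h (real n)"
          using H d(1) by (simp add: H_def diff_divide_distrib)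
        ultimately have "\<bar>h t - h (real n)\<bar> \<le> C / s * h (real n)"
          using H d(1) by (simp add: H_def abs_divide pos_divide_le_eq)
        also have "\<dots> \<le> C / s * ((1 + d) / d * H)"
        proof (rule mult_left_mono)
          have "h (real n) * d \<le> (1 + d) * H"
            using H by (simp add: H_def algebra_simps)
          then show "h (real n) \<le> (1 + d) / d * H"
            using d(1) by (simp add: pos_le_divide_eq)
        qed (use C s in simp)
        also have "C / s * ((1 + d) / d * H) = th * H"
          by (simp add: th_def K_def mult_ac)
        finally have "\<bar>h t - h (real n)\<bar> \<le> th * H" .
        then show ?thesis
          unfolding abs_le_iff by (auto simp: H_def algebra_simps)
      qed
      have Hth: "d * (1 - th) \<le> H * (1 - th)" "0 < d * (1 - th)"
        using H th d by auto
      \<comment> \<open>The decay lemma with \<open>m = H * (1 - th)\<close> yields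
        \<open>exp (- u)\<close> for \<open>u = H * (1 - th) * (s / 2)\<close>; the weaker
        \<open>1 / u\<close> is kept because its factor \<open>1 / H\<close> is needed for the tail
        beyond \<open>N\<close>.\<close>
      have kN: "real N / f N \<le> k * (1 / (H * (1 - th) * (s / 2)))"
      proof -
        have "real N / g (real N) \<le> real n / g (real n) * exp (- (H * (1 - th)) * ln (real N / real n))"
          using n nN h by (intro divide_g_decay) auto
        moreover have "real N / real n = real R" "g (real N) = f N" "g (real n) = f n"
          using n nN g_eq[of N] g_eq[of n] by (simp_all add: N_def)
        ultimately have "real N / f N \<le> k * exp (- (H * (1 - th)) * ln (real R))"
          by (simp only: k_def)
        also have "\<dots> \<le> k * exp (- (H * (1 - th) * (s / 2)))"
        proof -
          have "s / 2 \<le> ln (real R)"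
            using R(2) \<open>R \<ge> 1\<close> by (subst ln_ge_iff) auto
          then have "H * (1 - th) * (s / 2) \<le> H * (1 - th) * ln (real R)"
            using Hth by (intro mult_left_mono) auto
          then show ?thesis
            using k by simp
        qed
        also have "\<dots> \<le> k * (1 / (H * (1 - th) * (s / 2)))"
        proof -
          let ?u = "H * (1 - th) * (s / 2)"
          have "?u > 0" using H th d(1) s by (intro mult_pos_pos) auto
          moreover have "?u \<le> exp ?u" using exp_ge_add_one_self[of ?u] by linarith
          ultimately have "exp (- ?u) \<le> 1 / ?u"
            unfolding exp_minus inverse_eq_divide by (intro divide_left_mono) auto
          then show ?thesis using k by (intro mult_left_mono) auto
        qed
        finally show ?thesis .
      qed
      have split: "S1 f n = (\<Sum>j=n..<l. 1 / f j) + S1 f l" if "n \<le> l" for l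
      proof -
        have "S1 f n = (\<Sum>j. 1 / f (n + (j + (l - n)))) + (\<Sum>j<l-n. 1 / f (n + j))"
          unfolding S1_def by (rule suminf_split_initial_segment[OF summable_inverse_f])
        also have "(\<Sum>j. 1 / f (n + (j + (l - n)))) = S1 f l"
          unfolding S1_def using that by (intro suminf_cong) (simp add: add.commute)
        also have "(\<Sum>j<l-n. 1 / f (n + j)) = (\<Sum>j=n..<l. 1 / f j)"
          by (rule sum.reindex_bij_witness[of _ "\<lambda>j. j - n" "\<lambda>j. n + j"]) auto
        finally show ?thesis by simp
      qed
      let ?q = "1 / (d * (1 - th) * (s / 2))"
      \<comment> \<open>Replacing \<open>H\<close> by \<open>d\<close> gives an error term that
        depends on \<open>n\<close> through \<open>s\<close> alone.\<close>
      have q: "1 / (H * (1 - th) * (s / 2)) \<le> ?q"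
        using H th d(1) s by (intro divide_left_mono mult_right_mono mult_pos_pos) auto
      have "0 \<le> S1 f N"
        unfolding S1_def using nN n f_pos
        by (intro suminf_nonneg summable_inverse_f) (auto intro: less_imp_le)
      then have sum_le: "(\<Sum>j=n..<N. 1 / f j) \<le> S1 f n"
        using split[OF nN] by simp
      have "k * (1 - ?q) \<le> k - real N / f N"
        using kN mult_left_mono[OF q, of k] k unfolding right_diff_distrib mult_1_right by linarith
      also have "\<dots> \<le> H * (1 + th) * (\<Sum>j=n..<N. 1 / f j)"
        unfolding k_def
      proof (rule sum_lower_bound)
        show "0 \<le> h t - 1 \<and> h t - 1 \<le> H * (1 + th)" if "real n \<le> t" "t \<le> real N" for t
          using h[OF that] Hth by linarith
      qed (use n nN in auto)
      also have "\<dots> \<le> H * (1 + th) * S1 f n"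
        using H d(1) th by (intro mult_left_mono sum_le) auto
      finally have lower: "k * (1 - ?q) \<le> H * (1 + th) * S1 f n" .
      \<comment> \<open>The upper sum estimate controls the shifted terms
        \<open>1 / f (Suc j)\<close>, so \<open>1 / f n\<close> is split off; it contributes the
        summand \<open>H / n\<close>.\<close>
      have "S1 f n = 1 / f n + (\<Sum>j=n..<N. 1 / f (Suc j)) + S1 f (Suc N)"
        using split[of "Suc N"] nN sum.atLeast_Suc_lessThan[of n "Suc N" "\<lambda>j. 1 / f j"]
        by (simp only: sum.shift_bounds_Suc_ivl le_imp_less_Suc le_Suc_eq simp_thms)
      then have "H * S1 f n =
          H * (1 / f n) + H * (\<Sum>j=n..<N. 1 / f (Suc j)) + H * S1 f (Suc N)"
        by (simp only: distrib_left)
      also have "H * (1 / f n) = k * (H / real n)"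
        using n by (simp add: k_def)
      also have "H * (\<Sum>j=n..<N. 1 / f (Suc j)) \<le> k * (1 / (1 - th))"
      proof -
        have "H * (1 - th) * (\<Sum>j=n..<N. 1 / f (Suc j)) \<le> real n / f n - real N / f N"
          using n nN Hth by (intro sum_upper_bound) (linarith | use h in blast)+
        also have "\<dots> \<le> k"
          using f_pos[of N] n nN by (simp add: k_def)
        finally show ?thesis
          using th by (simp add: pos_le_divide_eq mult_ac)
      qed
      \<comment> \<open>The crude tail bound loses a factor \<open>H / d\<close>, which the
        \<open>1 / H\<close> in \<open>kN\<close> compensates.\<close>
      also have "H * S1 f (Suc N) \<le> k * ?q"
      proof -
        have "S1 f (Suc N) \<le> real N / f N / d"
          using n nN d(1) by (intro tail_bound(2) d(3)) auto
        also have "\<dots> \<le> k * (1 / (H * (1 - th) * (s / 2))) / d"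
          using kN d(1) by (intro divide_right_mono) auto
        finally have "H * S1 f (Suc N) \<le> H * (k * (1 / (H * (1 - th) * (s / 2))) / d)"
          using H d(1) by (intro mult_left_mono) auto
        also have "\<dots> = k * ?q"
          using H d(1) by (simp add: mult_ac)
        finally show ?thesis .
      qed
      finally have upper: "H * S1 f n \<le> k * (H / real n + 1 / (1 - th) + ?q)"
        by (simp add: distrib_left)
      have "(1 - ?q) / (1 + th) \<le> S1 f n * H / k" "S1 f n * H / k \<le> H / real n + 1 / (1 - th) + ?q"
        using lower upper k th
        by (simp_all add: pos_divide_le_eq pos_le_divide_eq mult_ac)
      then show ?case
        by (simp add: Let_def s_def[symmetric] H_def[symmetric] th_def[symmetric] k_def[symmetric])
    qed
  qed
qed

lemma S1_ratio_tendsto: "(\<lambda>n. S1 f n * (h (real n) - 1) / (real n / f n)) \<longlonglongrightarrow> 1"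
proof -
  obtain K d where Kd: "K > 0" "d > 0" and bounds:
    "\<forall>\<^sub>F n in sequentially.
      let s = sqrt (ln (real n)); H = h (real n) - 1; r = S1 f n * H / (real n / f n)
      in (1 - 1 / (d * (1 - K / s) * (s / 2))) / (1 + K / s) \<le> r \<and>
         r \<le> H / real n + 1 / (1 - K / s) + 1 / (d * (1 - K / s) * (s / 2))"
    by (rule S1_ratio_bounds) blast
  have "(\<lambda>n. 1 / (1 - K / sqrt (ln (real n))) +
      1 / (d * (1 - K / sqrt (ln (real n))) * (sqrt (ln (real n)) / 2)))
      \<longlonglongrightarrow> 1"
    using Kd by real_asymp
  from tendsto_add[OF h_over_n_tendsto this]
  have upper: "(\<lambda>n. (h (real n) - 1) / real n + 1 / (1 - K / sqrt (ln (real n))) +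
      1 / (d * (1 - K / sqrt (ln (real n))) * (sqrt (ln (real n)) / 2))) \<longlonglongrightarrow> 1"
    by (simp add: add.assoc)
  have lower: "(\<lambda>n. (1 - 1 / (d * (1 - K / sqrt (ln (real n))) * (sqrt (ln (real n)) / 2))) /
      (1 + K / sqrt (ln (real n)))) \<longlonglongrightarrow> 1"
    using Kd by real_asymp
  show ?thesis
    by (rule tendsto_sandwich[OF _ _ lower upper]; use bounds in eventually_elim) (auto simp: Let_def)
qed

lemma S1_pos: "S1 f (Suc n) > 0"
  unfolding S1_def using f_pos by (intro suminf_pos summable_inverse_f) auto

lemma S1_asymp_equiv:
  "S1 f \<sim>[sequentially] (\<lambda>n. real n / ((h (real n) - 1) * f n))"
proof (rule asymp_equivI')
  have "S1 f n * (h (real n) - 1) / (real n / f n) = S1 f n / (real n / ((h (real n) - 1) * f n))" for n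
    by (simp add: mult.assoc)
  then show "(\<lambda>n. S1 f n / (real n / ((h (real n) - 1) * f n))) \<longlonglongrightarrow> 1"
    using S1_ratio_tendsto by (simp only:)
qed

text \<open>The event \<open>L > n\<close> leads to a tail starting at \<open>n + 1\<close>. The
  discarded term relative to \<open>S1 f n\<close> is \<open>(h n - 1) / n\<close> divided by a
  ratio tending to 1.\<close>

lemma S1_Suc_asymp_equiv: "(\<lambda>n. S1 f (Suc n)) \<sim>[sequentially] S1 f"
proof (rule asymp_equivI')
  have "(\<lambda>n. 1 - (h (real n) - 1) / real n / (S1 f n * (h (real n) - 1) / (real n / f n))) \<longlonglongrightarrow> 1 - 0 / 1"
    by (intro tendsto_intros h_over_n_tendsto S1_ratio_tendsto) simp
  moreover have "\<forall>\<^sub>F n in sequentially.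
      1 - (h (real n) - 1) / real n / (S1 f n * (h (real n) - 1) / (real n / f n)) = S1 f (Suc n) / S1 f n"
  proof -
    obtain d x1 where d: "d > 0" "\<And>x. x \<ge> x1 \<Longrightarrow> h x \<ge> 1 + d"
      by (rule h_ge) blast
    have "\<forall>\<^sub>F n in sequentially. real n \<ge> max x1 1"
      by real_asymp
    then show ?thesis
    proof eventually_elim
      case (elim n)
      have "h (real n) - 1 > 0" using d(1) d(2)[of "real n"] elim by simp
      moreover have "f n > 0" using f_pos elim by simp
      moreover obtain k where "n = Suc k" using elim by (cases n) auto
      then have "S1 f n > 0" using S1_pos by simp
      moreover have "S1 f n = 1 / f n + S1 f (Suc n)"
        using suminf_split_head[OF summable_inverse_f[of n]] by (simp add: S1_def)
      then have "S1 f (Suc n) / S1 f n = (S1 f n - 1 / f n) / S1 f n"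
        by simp
      then have "S1 f (Suc n) / S1 f n = 1 - 1 / f n / S1 f n"
        using \<open>S1 f n > 0\<close> by (simp only: diff_divide_distrib) simp
      ultimately show ?case
        using elim by simp
    qed
  qed
  ultimately show "(\<lambda>n. S1 f (Suc n) / S1 f n) \<longlonglongrightarrow> 1"
    by (simp add: Lim_transform_eventually)
qed

end

section \<open>The chain\<close>

text \<open>The whole space is the cylinder over the empty index set.\<close>

lemma prob_space_bins_measure: "prob_space (bins_measure f u)"
proof -
  have "emeasure (bins_measure f u) (space (bins_measure f u)) =
      emeasure (bins_measure f u) (prod_emb UNIV (\<lambda>_. count_space UNIV) {0..<0} {\<lambda>_. undefined})"
    by (simp add: space_bins_measure prod_emb_def restrict_def space_PiM)
  also have "\<dots> = emeasure (bins.C f u 0 0 (\<lambda>_. undefined)) {\<lambda>_. undefined}"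
    by (rule emeasure_bins_measure) (simp add: sets_PiM_empty)
  also have "\<dots> = 1"
    using emeasure_bins_C[of f u 0 "\<lambda>_. undefined"] by (simp add: restrict_def)
  finally show ?thesis by (rule prob_spaceI)
qed

interpretation bins_prob: prob_space "bins_measure f u" for f u
  by (rule prob_space_bins_measure)

lemma measurable_bins_coordinate [measurable]:
  "(\<lambda>\<omega>. \<omega> m) \<in> measurable (bins_measure f u) (count_space UNIV)"
  by (subst measurable_cong_sets[OF sets_bins_measure refl]) (rule measurable_component_singleton, simp)

text \<open>The Markov property at one time: the cylinder formula is summed over the countably many
  histories up to time \<open>m\<close> ending in \<open>s\<close>, encoded as lists of length
  \<open>m + 1\<close>.\<close>

lemma bins_measure_step:
  "bins_prob.prob f u {\<omega>. \<omega> m = s \<and> \<omega> (Suc m) = t} =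
     bins_prob.prob f u {\<omega>. \<omega> m = s} * pmf (bins_step f s) t"
proof -
  let ?M = "bins_measure f u"
  let ?X = "\<lambda>l. {\<omega>. (\<forall>i\<le>m. \<omega> i = l ! i)}"
  let ?Y = "\<lambda>l. {\<omega>. (\<forall>i\<le>m. \<omega> i = l ! i) \<and> \<omega> (Suc m) = t}"
  let ?I = "{l. length l = Suc m \<and> l ! m = s}"
  have sets: "?X l \<in> sets ?M" "?Y l \<in> sets ?M" for l
  proof -
    have "{\<omega> \<in> space ?M. \<forall>i\<le>m. \<omega> i = l ! i} \<in> sets ?M"
      "{\<omega> \<in> space ?M. (\<forall>i\<le>m. \<omega> i = l ! i) \<and> \<omega> (Suc m) = t} \<in> sets ?M"
      by measurable
    then show "?X l \<in> sets ?M" "?Y l \<in> sets ?M"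
      by (simp_all add: space_bins_measure)
  qed
  have disj: "disjoint_family_on ?X ?I" "disjoint_family_on ?Y ?I"
  proof -
    have "l = l'" if "l \<in> ?I" "l' \<in> ?I" "\<forall>i\<le>m. \<omega> i = l ! i" "\<forall>i\<le>m. \<omega> i = l' ! i"
      for l l' and \<omega> :: "nat \<Rightarrow> nat \<times> nat"
      using that by (intro nth_equalityI) (auto simp: less_Suc_eq_le)
    then show "disjoint_family_on ?X ?I" "disjoint_family_on ?Y ?I"
      unfolding disjoint_family_on_def by blast+
  qed
  have mem: "map \<omega> [0..<Suc m] \<in> ?I" "\<omega> \<in> ?X (map \<omega> [0..<Suc m])" if "\<omega> m = s"
    for \<omega> :: "nat \<Rightarrow> nat \<times> nat"
    using that by (auto simp del: upt_Suc)
  have UN: "{\<omega>. \<omega> m = s} = (\<Union>l\<in>?I. ?X l)" "{\<omega>. \<omega> m = s \<and> \<omega> (Suc m) = t} = (\<Union>l\<in>?I. ?Y l)"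
  proof -
    have 1: "(\<exists>l\<in>?I. \<omega> \<in> ?X l) \<longleftrightarrow> \<omega> m = s" for \<omega>
      using mem[of \<omega>] by (intro iffI bexI[of _ "map \<omega> [0..<Suc m]"]) (elim bexE, simp, assumption+)
    then show X: "{\<omega>. \<omega> m = s} = (\<Union>l\<in>?I. ?X l)"
      unfolding UN_iff[symmetric] by (intro set_eqI) simp
    have "{\<omega>. \<omega> m = s \<and> \<omega> (Suc m) = t} = {\<omega>. \<omega> m = s} \<inter> {\<omega>. \<omega> (Suc m) = t}"
      by (rule Collect_conj_eq)
    also have "\<dots> = (\<Union>l\<in>?I. ?X l \<inter> {\<omega>. \<omega> (Suc m) = t})"
      unfolding X by (simp only: UN_extend_simps(4))
    also have "\<dots> = (\<Union>l\<in>?I. ?Y l)"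
      unfolding Collect_conj_eq ..
    finally show "{\<omega>. \<omega> m = s \<and> \<omega> (Suc m) = t} = (\<Union>l\<in>?I. ?Y l)" .
  qed
  have eY: "emeasure ?M (?Y l) = emeasure ?M (?X l) * ennreal (pmf (bins_step f s) t)" if "l \<in> ?I" for l
  proof -
    let ?w = "\<lambda>i. if i \<le> m then l ! i else t"
    have "?X l = {\<omega>. \<forall>i\<le>m. \<omega> i = ?w i}" "?Y l = {\<omega>. \<forall>i\<le>Suc m. \<omega> i = ?w i}"
      by (auto simp: le_Suc_eq)
    then show ?thesis
      using that by (simp only: bins_measure_cylinder)
        (auto simp: ennreal_mult[symmetric] prod_nonneg)
  qed
  have "emeasure ?M {\<omega>. \<omega> m = s \<and> \<omega> (Suc m) = t} =
      emeasure ?M {\<omega>. \<omega> m = s} * ennreal (pmf (bins_step f s) t)"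
    unfolding UN using sets disj
    by (simp add: emeasure_UN_countable eY nn_integral_multc cong: nn_integral_cong_simp)
  then show ?thesis
    unfolding bins_prob.emeasure_eq_measure by (simp add: ennreal_mult[symmetric])
qed

lemma pmf_bins_step:
  assumes "f a > 0" "f b > 0"
  shows "pmf (bins_step f (a, b)) (Suc a, b) = f a / (f a + f b)"
    and "pmf (bins_step f (a, b)) (a, Suc b) = f b / (f a + f b)"
proof -
  let ?F = "\<lambda>first. if first then (Suc a, b) else (a, Suc b)"
  have step: "bins_step f (a, b) = map_pmf ?F (bernoulli_pmf (f a / (f a + f b)))"
    unfolding bins_step_def fst_conv snd_conv ..
  have inj: "inj ?F" by (auto simp: inj_def)
  show "pmf (bins_step f (a, b)) (Suc a, b) = f a / (f a + f b)"
    using assms pmf_map_inj'[OF inj, of "bernoulli_pmf (f a / (f a + f b))" True] by (simp add: step)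
  have "1 - f a / (f a + f b) = f b / (f a + f b)"
    using assms by (simp add: field_simps)
  then show "pmf (bins_step f (a, b)) (a, Suc b) = f b / (f a + f b)"
    using assms pmf_map_inj'[OF inj, of "bernoulli_pmf (f a / (f a + f b))" False] by (simp add: step)
qed

text \<open>The algebra of the factor \<open>1 / A i + 1 / B j\<close>: its product with either
  transition probability, the resulting form of the averaging recursion, and the starting
  value.\<close>

lemma reciprocal_sum_mult:
  fixes a b p q :: real
  assumes "a > 0" "b > 0"
  shows "p * (1 / a + 1 / b) * (a / (a + b)) = p / b"
    and "p * (1 / a + 1 / b) * (b / (a + b)) = p / a"
    and "(a * p + b * q) / (a + b) * (1 / a + 1 / b) = p / b + q / a"
    and "a * b / (a + b) * (1 / a + 1 / b) = 1"
proof -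
  have *: "1 / a + 1 / b = (a + b) / (a * b)"
    using assms by (simp add: field_simps)
  show "p * (1 / a + 1 / b) * (a / (a + b)) = p / b" "p * (1 / a + 1 / b) * (b / (a + b)) = p / a"
    using assms unfolding * by simp_all
  have "(a * p + b * q) / (a + b) * ((a + b) / (a * b)) = (a * p + b * q) / (a * b)"
    using assms by simp
  also have "\<dots> = p / b + q / a"
    using assms by (simp add: add_divide_distrib)
  finally show "(a * p + b * q) / (a + b) * (1 / a + 1 / b) = p / b + q / a"
    unfolding * .
  show "a * b / (a + b) * (1 / a + 1 / b) = 1"
    using assms unfolding * by simp
qed

section \<open>Almost sure shape of the paths\<close>

lemma AE_bins_not:
  assumes "{\<omega> \<in> space (bins_measure f u). P \<omega>} \<in> sets (bins_measure f u)"
    and "bins_prob.prob f u {\<omega>. P \<omega>} = 0"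
  shows "AE \<omega> in bins_measure f u. \<not> P \<omega>"
  using assms bins_prob.prob_eq_0[OF assms(1)] by (simp add: space_bins_measure)

text \<open>The path space contains arbitrary sequences of states; pathwise arguments take place on
  this set of full measure.\<close>

definition bins_path :: "nat \<times> nat \<Rightarrow> (nat \<Rightarrow> nat \<times> nat) \<Rightarrow> bool" where
  "bins_path u \<omega> \<longleftrightarrow> \<omega> 0 = u \<and>
     (\<forall>m. \<omega> (Suc m) = (Suc (fst (\<omega> m)), snd (\<omega> m)) \<or> \<omega> (Suc m) = (fst (\<omega> m), Suc (snd (\<omega> m))))"

text \<open>Each forbidden transition from \<open>s\<close> to \<open>t\<close> at time
  \<open>m\<close> is a null event, and there are only countably many triples
  \<open>(m, s, t)\<close>.\<close>

lemma AE_bins_path: "AE \<omega> in bins_measure f u. bins_path u \<omega>"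
proof -
  have "emeasure (bins_measure f u) {\<omega>. \<omega> 0 = u} = 1"
    using bins_measure_cylinder[of f u 0 "\<lambda>_. u"] by simp
  then have 0: "AE \<omega> in bins_measure f u. \<omega> 0 = u"
    by (subst bins_prob.AE_iff_emeasure_eq_1) (simp_all add: space_bins_measure)
  have "AE \<omega> in bins_measure f u. \<omega> m = s \<longrightarrow> \<omega> (Suc m) = t \<longrightarrow> t \<in> set_pmf (bins_step f s)" for m s t
  proof (cases "t \<in> set_pmf (bins_step f s)")
    case False
    then have "AE \<omega> in bins_measure f u. \<not> (\<omega> m = s \<and> \<omega> (Suc m) = t)"
      by (intro AE_bins_not) (measurable, simp add: bins_measure_step set_pmf_iff)
    then show ?thesis by eventually_elim simp
  qed simp
  then have "AE \<omega> in bins_measure f u. \<forall>m s t.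
      \<omega> m = s \<longrightarrow> \<omega> (Suc m) = t \<longrightarrow> t \<in> set_pmf (bins_step f s)"
    by (intro AE_all_countable[THEN iffD2] allI)
  with 0 show ?thesis
    by eventually_elim (auto simp: bins_path_def bins_step_def split: if_splits)
qed

lemma bins_path_sum:
  assumes "bins_path u \<omega>"
  shows "fst (\<omega> m) + snd (\<omega> m) = fst u + snd u + m"
proof (induction m)
  case (Suc m)
  then show ?case
    using assms[unfolded bins_path_def, THEN conjunct2, rule_format, of m] by auto
qed (use assms in \<open>simp add: bins_path_def\<close>)

lemma bins_path_mono:
  assumes "bins_path u \<omega>"
  shows "mono (\<lambda>m. fst (\<omega> m))" "mono (\<lambda>m. snd (\<omega> m))"
proof -
  have "fst (\<omega> m) \<le> fst (\<omega> (Suc m)) \<and> snd (\<omega> m) \<le> snd (\<omega> (Suc m))" for m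
    using assms[unfolded bins_path_def, THEN conjunct2, rule_format, of m] by auto
  then show "mono (\<lambda>m. fst (\<omega> m))" "mono (\<lambda>m. snd (\<omega> m))"
    by (simp_all add: mono_iff_le_Suc)
qed

lemma bins_path_ge:
  assumes "bins_path u \<omega>"
  shows "fst u \<le> fst (\<omega> m)" "snd u \<le> snd (\<omega> m)"
  using bins_path_mono[OF assms, THEN monoD, of 0 m] assms by (simp_all add: bins_path_def)

section \<open>Visit probabilities by decomposition at the last step\<close>

lemma prob_bins_coordinate_Suc:
  "bins_prob.prob f u {\<omega>. \<omega> (Suc m) = (Suc a, Suc b)} =
     bins_prob.prob f u {\<omega>. \<omega> m = (a, Suc b)} * pmf (bins_step f (a, Suc b)) (Suc a, Suc b) +
     bins_prob.prob f u {\<omega>. \<omega> m = (Suc a, b)} * pmf (bins_step f (Suc a, b)) (Suc a, Suc b)"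
proof -
  let ?E = "\<lambda>s. {\<omega> \<in> space (bins_measure f u). \<omega> m = s \<and> \<omega> (Suc m) = (Suc a, Suc b)}"
  have E: "?E s \<in> sets (bins_measure f u)" for s by measurable
  have "bins_prob.prob f u {\<omega> \<in> space (bins_measure f u). \<omega> (Suc m) = (Suc a, Suc b)} =
      bins_prob.prob f u (?E (a, Suc b) \<union> ?E (Suc a, b))"
  proof (rule bins_prob.finite_measure_eq_AE)
    show "AE \<omega> in bins_measure f u. (\<omega> \<in> {\<omega> \<in> space (bins_measure f u). \<omega> (Suc m) = (Suc a, Suc b)}) =
        (\<omega> \<in> ?E (a, Suc b) \<union> ?E (Suc a, b))"
      using AE_bins_path
    proof eventually_elim
      case (elim \<omega>)
      then have "\<omega> (Suc m) = (Suc (fst (\<omega> m)), snd (\<omega> m)) \<or> \<omega> (Suc m) = (fst (\<omega> m), Suc (snd (\<omega> m)))"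
        by (simp add: bins_path_def)
      then show ?case by (cases "\<omega> m") auto
    qed
    show "?E (a, Suc b) \<union> ?E (Suc a, b) \<in> sets (bins_measure f u)"
      using E by blast
  qed measurable
  also have "\<dots> = bins_prob.prob f u (?E (a, Suc b)) + bins_prob.prob f u (?E (Suc a, b))"
    using E by (intro bins_prob.finite_measure_Union) auto
  finally show ?thesis
    by (simp add: space_bins_measure bins_measure_step)
qed

lemma prob_bins_coordinate_eq_0:
  assumes "fst s < fst u \<or> snd s < snd u"
  shows "bins_prob.prob f u {\<omega>. \<omega> m = s} = 0"
proof -
  have "AE \<omega> in bins_measure f u. \<not> \<omega> m = s"
    using AE_bins_path
  proof eventually_elim
    case (elim \<omega>)
    then show ?case
      using bins_path_ge[OF elim, of m] assms by auto
  qed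
  then have "bins_prob.prob f u {\<omega> \<in> space (bins_measure f u). \<omega> m = s} = 0"
    by (subst bins_prob.prob_eq_0) simp_all
  then show ?thesis by (simp add: space_bins_measure)
qed

text \<open>By the last-step decomposition and the induction hypothesis, the visit probability is
  \<open>w (i - 1) j / B j + w i (j - 1) / A i\<close>, which the averaging recursion turns into
  \<open>w i j * (1 / A i + 1 / B j)\<close>. On the edges one summand is absent.\<close>

lemma prob_bins_visit:
  assumes f: "\<And>n. n \<ge> 1 \<Longrightarrow> f n > 0" and "x \<ge> 1" "y \<ge> 1"
  shows "bins_prob.prob f (x, y) {\<omega>. \<omega> (i + j) = (x + i, y + j)} =
    meet (\<lambda>i. f (x + i)) (\<lambda>j. f (y + j)) i j * (1 / f (x + i) + 1 / f (y + j))"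
proof (induction "i + j" arbitrary: i j rule: less_induct)
  case less
  let ?m = "meet (\<lambda>i. f (x + i)) (\<lambda>j. f (y + j))"
  let ?P = "\<lambda>m s. bins_prob.prob f (x, y) {\<omega>. \<omega> m = s}"
  have pos: "f (x + i) > 0" "f (y + j) > 0" for i j
    using assms by auto
  \<comment> \<open>If \<open>a = x\<close> or \<open>b = y\<close>, the corresponding predecessor
    lies below the starting state and has probability 0, so its term vanishes whatever the value of
    \<open>f\<close> there, possibly \<open>f 0\<close>.\<close>
  have step: "?P (Suc m) (a, b) = ?P m (a - 1, b) * (f (a - 1) / (f (a - 1) + f b)) +
      ?P m (a, b - 1) * (f (b - 1) / (f a + f (b - 1)))" if ge: "a \<ge> x" "b \<ge> y" for m a b
  proof -
    obtain a' b' where ab: "a = Suc a'" "b = Suc b'"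
      using ge assms by (cases a; cases b) auto
    have "?P m (a', b) * pmf (bins_step f (a', b)) (a, b) = ?P m (a', b) * (f a' / (f a' + f b))"
    proof (cases "a' \<ge> x")
      case True
      then show ?thesis using pmf_bins_step(1)[of f a' b] f ab assms by simp
    qed (simp add: prob_bins_coordinate_eq_0)
    moreover have "?P m (a, b') * pmf (bins_step f (a, b')) (a, b) = ?P m (a, b') * (f b' / (f a + f b'))"
    proof (cases "b' \<ge> y")
      case True
      then show ?thesis using pmf_bins_step(2)[of f a b'] f ab assms by simp
    qed (simp add: prob_bins_coordinate_eq_0)
    ultimately show ?thesis
      using prob_bins_coordinate_Suc[of f "(x, y)" m a' b'] ab by simp
  qed
  note alg = reciprocal_sum_mult[OF pos]
  show ?case
  proof (cases i; cases j)
    assume "i = 0" "j = 0"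
    moreover have "?P 0 (x, y) = 1"
      using bins_measure_cylinder[of f "(x, y)" 0 "\<lambda>_. (x, y)"]
      by (simp add: bins_prob.emeasure_eq_measure)
    ultimately show ?thesis
      using alg(4)[of 0 0] by (simp only: meet.simps add_0_right)
  next
    fix i' assume i: "i = Suc i'" and j: "j = 0"
    have "?P (i + j) (x + i, y + j) = ?P (i' + 0) (x + i', y + 0) * (f (x + i') / (f (x + i') + f (y + 0)))"
      using step[of "x + i" y i'] i j assms(3) by (simp add: prob_bins_coordinate_eq_0)
    also have "\<dots> = ?m i' 0 / f (y + 0)"
      using i by (subst less) (simp, rule alg)
    also have "\<dots> = ?m i j * (1 / f (x + i) + 1 / f (y + j))"
      unfolding i j meet.simps using alg(3)[of "Suc i'" "?m i' 0" 0 0] by simp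
    finally show ?thesis .
  next
    fix j' assume i: "i = 0" and j: "j = Suc j'"
    have "?P (i + j) (x + i, y + j) = ?P (0 + j') (x + 0, y + j') * (f (y + j') / (f (x + 0) + f (y + j')))"
      using step[of x "y + j" j'] i j assms(2) by (simp add: prob_bins_coordinate_eq_0)
    also have "\<dots> = ?m 0 j' / f (x + 0)"
      using j by (subst less) (simp, rule alg)
    also have "\<dots> = ?m i j * (1 / f (x + i) + 1 / f (y + j))"
      unfolding i j meet.simps using alg(3)[of 0 0 "Suc j'" "?m 0 j'"] by simp
    finally show ?thesis .
  next
    fix i' j' assume i: "i = Suc i'" and j: "j = Suc j'"
    have "?P (i + j) (x + i, y + j) =
        ?P (i' + j) (x + i', y + j) * (f (x + i') / (f (x + i') + f (y + j))) +
        ?P (i + j') (x + i, y + j') * (f (y + j') / (f (x + i) + f (y + j')))"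
      using step[of "x + i" "y + j" "i' + j"] i j by simp
    also have "\<dots> = ?m i' j / f (y + j) + ?m i j' / f (x + i)"
    proof -
      have "i' + j < i + j" "i + j' < i + j" using i j by simp_all
      then show ?thesis by (simp only: less alg)
    qed
    also have "\<dots> = ?m i j * (1 / f (x + i) + 1 / f (y + j))"
      unfolding i j meet.simps alg(3) ..
    finally show ?thesis .
  qed
qed

section \<open>The losing number\<close>

text \<open>A nondecreasing integer sequence is either eventually equal to \<open>a\<close> or
  eventually different from \<open>a\<close>. Thus the indicators converge almost surely, and
  dominated convergence applies.\<close>

lemma prob_eventually_coordinate:
  assumes p: "\<And>\<omega>. bins_path u \<omega> \<Longrightarrow> mono (\<lambda>m. p (\<omega> m) :: nat)"
    and lim: "(\<lambda>m. bins_prob.prob f u {\<omega>. p (\<omega> m) = a}) \<longlonglongrightarrow> l"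
  shows "bins_prob.prob f u {\<omega>. \<forall>\<^sub>F m in sequentially. p (\<omega> m) = a} = l"
proof -
  let ?M = "bins_measure f u"
  let ?E = "\<lambda>m. {\<omega> \<in> space ?M. p (\<omega> m) = a}"
  let ?F = "{\<omega> \<in> space ?M. \<forall>\<^sub>F m in sequentially. p (\<omega> m) = a}"
  have [measurable]: "p \<in> measurable (count_space UNIV) (count_space UNIV)"
    by simp
  have E: "?E m \<in> sets ?M" for m by measurable
  have F: "?F \<in> sets ?M" unfolding eventually_sequentially by measurable
  have "(\<lambda>m. \<integral>\<omega>. indicator (?E m) \<omega> \<partial>?M) \<longlonglongrightarrow> (\<integral>\<omega>. indicator ?F \<omega> \<partial>?M :: real)"
  proof (rule integral_dominated_convergence[where w = "\<lambda>_. 1"])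
    show "AE \<omega> in ?M. (\<lambda>m. indicator (?E m) \<omega> :: real) \<longlonglongrightarrow> indicator ?F \<omega>"
      using AE_bins_path
    proof eventually_elim
      case (elim \<omega>)
      have mono: "p (\<omega> k) \<le> p (\<omega> m)" if "k \<le> m" for k m
        using p[OF elim] that by (rule monoD)
      have "\<forall>\<^sub>F m in sequentially. indicator (?E m) \<omega> = (indicator ?F \<omega> :: real)"
      proof (cases "\<forall>\<^sub>F m in sequentially. p (\<omega> m) = a")
        case True
        then show ?thesis
          by (rule eventually_mono) (use True in \<open>simp add: space_bins_measure\<close>)
      next
        case False
        have "\<exists>N. \<forall>m\<ge>N. p (\<omega> m) \<noteq> a"
        proof (cases "\<exists>k. p (\<omega> k) > a")
          case True
          then show ?thesis using mono by (metis leD)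
        next
          case no_gt: False
          have "p (\<omega> k) \<noteq> a" for k
          proof
            assume "p (\<omega> k) = a"
            then have "p (\<omega> m) = a" if "m \<ge> k" for m
              using mono[OF that] no_gt by (metis le_antisym not_le)
            with False show False
              by (auto simp: eventually_sequentially)
          qed
          then show ?thesis by blast
        qed
        then have "\<forall>\<^sub>F m in sequentially. p (\<omega> m) \<noteq> a"
          by (simp add: eventually_sequentially)
        then show ?thesis
          by (rule eventually_mono) (use False in \<open>simp add: space_bins_measure\<close>)
      qed
      then show ?case by (rule tendsto_eventually)
    qed
    show "indicator ?F \<in> borel_measurable ?M" "indicator (?E m) \<in> borel_measurable ?M" for m
      by (rule borel_measurable_indicator[OF F] borel_measurable_indicator[OF E])+
  qed simp_all
  then have "(\<lambda>m. bins_prob.prob f u (?E m)) \<longlonglongrightarrow> bins_prob.prob f u ?F"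
    using E F by (simp only: Bochner_Integration.integral_indicator scaleR_one) simp
  with lim show ?thesis
    by (simp add: space_bins_measure LIMSEQ_unique)
qed

text \<open>At time \<open>m\<close> the total number of balls is \<open>x + y + m\<close>, so one
  coordinate determines the other. The times are written in the form that the visit formula
  expects.\<close>

lemma prob_bins_line:
  assumes "x \<ge> 1" "y \<ge> 1"
  shows "m \<ge> i \<Longrightarrow> bins_prob.prob f (x, y) {\<omega>. fst (\<omega> m) = x + i} =
      bins_prob.prob f (x, y) {\<omega>. \<omega> (i + (m - i)) = (x + i, y + (m - i))}"
    and "m \<ge> j \<Longrightarrow> bins_prob.prob f (x, y) {\<omega>. snd (\<omega> m) = y + j} =
      bins_prob.prob f (x, y) {\<omega>. \<omega> ((m - j) + j) = (x + (m - j), y + j)}"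
proof -
  have *: "bins_prob.prob f (x, y) {\<omega>. P (\<omega> m)} = bins_prob.prob f (x, y) {\<omega>. \<omega> m = s}"
    if "\<And>a b. a + b = x + y + m \<Longrightarrow> P (a, b) \<longleftrightarrow> (a, b) = s" for P and s :: "nat \<times> nat"
  proof -
    have "AE \<omega> in bins_measure f (x, y). \<omega> \<in> {\<omega> \<in> space (bins_measure f (x, y)). P (\<omega> m)} \<longleftrightarrow>
        \<omega> \<in> {\<omega> \<in> space (bins_measure f (x, y)). \<omega> m = s}"
      using AE_bins_path
    proof eventually_elim
      case (elim \<omega>)
      then show ?case
        using that bins_path_sum[OF elim, of m] by (cases "\<omega> m") auto
    qed
    moreover have [measurable]: "P \<in> measurable (count_space UNIV) (count_space UNIV)" by simp
    ultimately have "bins_prob.prob f (x, y) {\<omega> \<in> space (bins_measure f (x, y)). P (\<omega> m)} =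
        bins_prob.prob f (x, y) {\<omega> \<in> space (bins_measure f (x, y)). \<omega> m = s}"
      by (intro bins_prob.finite_measure_eq_AE) simp_all
    then show ?thesis by (simp add: space_bins_measure)
  qed
  show "bins_prob.prob f (x, y) {\<omega>. fst (\<omega> m) = x + i} =
      bins_prob.prob f (x, y) {\<omega>. \<omega> (i + (m - i)) = (x + i, y + (m - i))}" if "m \<ge> i"
    unfolding le_add_diff_inverse[OF that]
    by (rule *[of "\<lambda>s. fst s = x + i"]) (use that in auto)
  show "bins_prob.prob f (x, y) {\<omega>. snd (\<omega> m) = y + j} =
      bins_prob.prob f (x, y) {\<omega>. \<omega> ((m - j) + j) = (x + (m - j), y + j)}" if "m \<ge> j"
    unfolding le_add_diff_inverse2[OF that]
    by (rule *[of "\<lambda>s. snd s = y + j"]) (use that in auto)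
qed

lemma transient_meeting_shift:
  assumes "\<And>n. n \<ge> 1 \<Longrightarrow> f n > 0" "x \<ge> 1" "y \<ge> 1" "\<And>n. summable (\<lambda>j. 1 / f (n + j))"
  shows "transient_meeting (\<lambda>i. f (x + i)) (\<lambda>j. f (y + j))"
  by unfold_locales (use assms in auto)

text \<open>In the visit formula with \<open>i\<close> fixed, the weight tends to
  \<open>meet_lim i\<close> and the reciprocal belonging to the second bin tends to 0.\<close>

lemma prob_eventually_fst:
  assumes "\<And>n. n \<ge> 1 \<Longrightarrow> f n > 0" "x \<ge> 1" "y \<ge> 1" "\<And>n. summable (\<lambda>j. 1 / f (n + j))"
  shows "bins_prob.prob f (x, y) {\<omega>. \<forall>\<^sub>F m in sequentially. fst (\<omega> m) = x + i} =
    transient_meeting.meet_lim (\<lambda>i. f (x + i)) (\<lambda>j. f (y + j)) i / f (x + i)"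
proof (rule prob_eventually_coordinate)
  interpret transient_meeting "\<lambda>i. f (x + i)" "\<lambda>j. f (y + j)"
    by (rule transient_meeting_shift[OF assms])
  have "(\<lambda>k. meet (\<lambda>i. f (x + i)) (\<lambda>j. f (y + j)) i k * (1 / f (x + i) + 1 / f (y + k)))
      \<longlonglongrightarrow> meet_lim i * (1 / f (x + i) + 0)"
    by (intro tendsto_intros meet_lim summable_LIMSEQ_zero B_summable)
  then have "(\<lambda>k. bins_prob.prob f (x, y) {\<omega>. fst (\<omega> (k + i)) = x + i}) \<longlonglongrightarrow> meet_lim i / f (x + i)"
    using assms(1-3) by (simp add: prob_bins_line(1) prob_bins_visit)
  then show "(\<lambda>m. bins_prob.prob f (x, y) {\<omega>. fst (\<omega> m) = x + i}) \<longlonglongrightarrow> meet_lim i / f (x + i)"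
    by (rule LIMSEQ_offset)
qed (rule bins_path_mono)

lemma prob_eventually_snd:
  assumes "\<And>n. n \<ge> 1 \<Longrightarrow> f n > 0" "x \<ge> 1" "y \<ge> 1" "\<And>n. summable (\<lambda>j. 1 / f (n + j))"
  shows "bins_prob.prob f (x, y) {\<omega>. \<forall>\<^sub>F m in sequentially. snd (\<omega> m) = y + j} =
    transient_meeting.meet_lim (\<lambda>j. f (y + j)) (\<lambda>i. f (x + i)) j / f (y + j)"
proof (rule prob_eventually_coordinate)
  interpret transient_meeting "\<lambda>j. f (y + j)" "\<lambda>i. f (x + i)"
    by (rule transient_meeting_shift[OF assms(1,3,2,4)])
  have "(\<lambda>k. meet (\<lambda>j. f (y + j)) (\<lambda>i. f (x + i)) j k * (1 / f (y + j) + 1 / f (x + k)))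
      \<longlonglongrightarrow> meet_lim j * (1 / f (y + j) + 0)"
    by (intro tendsto_intros meet_lim summable_LIMSEQ_zero B_summable)
  moreover have "bins_prob.prob f (x, y) {\<omega>. snd (\<omega> (k + j)) = y + j} =
      meet (\<lambda>j. f (y + j)) (\<lambda>i. f (x + i)) j k * (1 / f (y + j) + 1 / f (x + k))" for k
  proof -
    have "bins_prob.prob f (x, y) {\<omega>. snd (\<omega> (k + j)) = y + j} =
        bins_prob.prob f (x, y) {\<omega>. \<omega> (k + j) = (x + k, y + j)}"
      using prob_bins_line(2)[OF assms(2,3), of j "k + j" f] by simp
    also have "\<dots> = meet (\<lambda>i. f (x + i)) (\<lambda>j. f (y + j)) k j * (1 / f (x + k) + 1 / f (y + j))"
      by (rule prob_bins_visit[OF assms(1-3)])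
    finally show ?thesis
      by (simp only: meet_commute[of "\<lambda>i. f (x + i)"] add.commute[of "1 / f (x + k)"])
  qed
  ultimately have "(\<lambda>k. bins_prob.prob f (x, y) {\<omega>. snd (\<omega> (k + j)) = y + j}) \<longlonglongrightarrow> meet_lim j / f (y + j)"
    by simp
  then show "(\<lambda>m. bins_prob.prob f (x, y) {\<omega>. snd (\<omega> m) = y + j}) \<longlonglongrightarrow> meet_lim j / f (y + j)"
    by (rule LIMSEQ_offset)
qed (rule bins_path_mono)

section \<open>The losing number through eventually constant coordinates\<close>

lemma eventually_Suc_eq_iff:
  fixes q :: "nat \<Rightarrow> nat"
  shows "(\<forall>\<^sub>F m in sequentially. q (Suc m) = q m) \<longleftrightarrow> (\<exists>a. \<forall>\<^sub>F m in sequentially. q m = a)"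
proof
  assume "\<forall>\<^sub>F m in sequentially. q (Suc m) = q m"
  then obtain N where N: "\<And>m. m \<ge> N \<Longrightarrow> q (Suc m) = q m"
    by (auto simp: eventually_sequentially)
  have "q m = q N" if "m \<ge> N" for m
    using that by (induction m rule: dec_induct) (use N in auto)
  then show "\<exists>a. \<forall>\<^sub>F m in sequentially. q m = a"
    by (auto simp: eventually_sequentially)
next
  assume "\<exists>a. \<forall>\<^sub>F m in sequentially. q m = a"
  then obtain a where a: "\<forall>\<^sub>F m in sequentially. q m = a" by blast
  then have "\<forall>\<^sub>F m in sequentially. q (Suc m) = a"
    by (rule eventually_sequentially_Suc[THEN iffD2])
  with a show "\<forall>\<^sub>F m in sequentially. q (Suc m) = q m"
    by eventually_elim simp
qed

lemma eventually_const_unique: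
  assumes "\<forall>\<^sub>F m in sequentially. q m = a" "\<forall>\<^sub>F m in sequentially. q m = b"
  shows "a = b"
proof -
  from assms have "\<forall>\<^sub>F m in sequentially. a = b"
    by eventually_elim simp
  then show ?thesis by simp
qed

lemma bins_path_not_both_const:
  assumes "bins_path u \<omega>"
  shows "\<not> ((\<forall>\<^sub>F m in sequentially. fst (\<omega> m) = a) \<and> (\<forall>\<^sub>F m in sequentially. snd (\<omega> m) = b))"
proof
  assume "(\<forall>\<^sub>F m in sequentially. fst (\<omega> m) = a) \<and> (\<forall>\<^sub>F m in sequentially. snd (\<omega> m) = b)"
  then have "\<forall>\<^sub>F m in sequentially. fst (\<omega> m) = a \<and> snd (\<omega> m) = b"
    by (simp add: eventually_conj_iff)
  then obtain N where "\<And>m. m \<ge> N \<Longrightarrow> fst (\<omega> m) = a \<and> snd (\<omega> m) = b"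
    by (auto simp: eventually_sequentially)
  \<comment> \<open>At this time the total would be \<open>a + b\<close>, yet at least
    \<open>N + a + b + 1\<close> balls have been added.\<close>
  from this[of "N + a + b + 1"] show False
    using bins_path_sum[OF assms, of "N + a + b + 1"] by simp
qed

text \<open>Along a genuine path a bin wins exactly when the other coordinate is eventually
  constant, and its constant value is the losing number. With no winner the conventional value 0
  makes both sides false.\<close>

lemma losing_number_gt_iff:
  assumes "bins_path u \<omega>"
  shows "losing_number \<omega> > n \<longleftrightarrow>
    (\<exists>k. (\<forall>\<^sub>F m in sequentially. fst (\<omega> m) = Suc n + k) \<or>
         (\<forall>\<^sub>F m in sequentially. snd (\<omega> m) = Suc n + k))"
proof -
  note not_both = bins_path_not_both_const[OF assms]
  have step: "fst (\<omega> (Suc m)) = Suc (fst (\<omega> m)) \<longleftrightarrow> snd (\<omega> (Suc m)) = snd (\<omega> m)"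
    "snd (\<omega> (Suc m)) = Suc (snd (\<omega> m)) \<longleftrightarrow> fst (\<omega> (Suc m)) = fst (\<omega> m)" for m
    using assms[unfolded bins_path_def, THEN conjunct2, rule_format, of m] by auto
  have wins: "wins_fst \<omega> \<longleftrightarrow> (\<exists>b. \<forall>\<^sub>F m in sequentially. snd (\<omega> m) = b)"
    "wins_snd \<omega> \<longleftrightarrow> (\<exists>a. \<forall>\<^sub>F m in sequentially. fst (\<omega> m) = a)"
    unfolding wins_fst_def wins_snd_def step
    by (rule eventually_Suc_eq_iff[of "\<lambda>m. snd (\<omega> m)"], rule eventually_Suc_eq_iff[of "\<lambda>m. fst (\<omega> m)"])
  have lim_eq: "lim q = a" if "\<forall>\<^sub>F m in sequentially. q m = a" for q :: "nat \<Rightarrow> nat" and a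
    using that by (intro limI tendsto_eventually)
  have ge: "n < a \<longleftrightarrow> (\<exists>k. a = Suc n + k)" for a
    unfolding less_iff_Suc_add by simp
  show "losing_number \<omega> > n \<longleftrightarrow>
    (\<exists>k. (\<forall>\<^sub>F m in sequentially. fst (\<omega> m) = Suc n + k) \<or>
         (\<forall>\<^sub>F m in sequentially. snd (\<omega> m) = Suc n + k))"
  proof (cases "wins_fst \<omega>")
    case True
    then obtain b where b: "\<forall>\<^sub>F m in sequentially. snd (\<omega> m) = b"
      using wins by blast
    then have "losing_number \<omega> = b"
      using True lim_eq[OF b] by (simp add: losing_number_def)
    moreover have "\<not> (\<forall>\<^sub>F m in sequentially. fst (\<omega> m) = c)" for c
      using b not_both by blast
    moreover have "(\<forall>\<^sub>F m in sequentially. snd (\<omega> m) = c) \<longleftrightarrow> b = c" for c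
      using b eventually_const_unique[OF b] by metis
    ultimately show ?thesis
      by (simp only: ge simp_thms)
  next
    case not_fst: False
    show ?thesis
    proof (cases "wins_snd \<omega>")
      case True
      then obtain a where a: "\<forall>\<^sub>F m in sequentially. fst (\<omega> m) = a"
        using wins by blast
      then have "losing_number \<omega> = a"
        using True not_fst lim_eq[OF a] by (simp add: losing_number_def)
      moreover have "\<not> (\<forall>\<^sub>F m in sequentially. snd (\<omega> m) = c)" for c
        using a not_both by blast
      moreover have "(\<forall>\<^sub>F m in sequentially. fst (\<omega> m) = c) \<longleftrightarrow> a = c" for c
        using a eventually_const_unique[OF a] by metis
      ultimately show ?thesis
        by (simp only: ge simp_thms)
    next
      case False
      then have "losing_number \<omega> = 0"
        using not_fst by (simp add: losing_number_def)
      then show ?thesis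
        using not_fst False by (simp add: wins)
    qed
  qed
qed

lemma measurable_losing_number:
  "losing_number \<in> measurable (bins_measure f u) (count_space UNIV)"
proof -
  let ?M = "bins_measure f u"
  have [measurable]: "p \<in> measurable (count_space UNIV) (count_space UNIV)" for p :: "nat \<times> nat \<Rightarrow> nat"
    by simp
  have lim: "(\<lambda>\<omega>. lim (\<lambda>m. p (\<omega> m))) \<in> measurable ?M (count_space UNIV)" for p :: "nat \<times> nat \<Rightarrow> nat"
    \<comment> \<open>In the discrete topology convergence means being eventually constant, so
      \<open>lim\<close> is a definite description over a countable range of measurable
      predicates.\<close>
    unfolding lim_def tendsto_discrete
  proof (rule measurable_THE[where I = UNIV])
    show "Measurable.pred ?M (\<lambda>\<omega>. \<forall>\<^sub>F m in sequentially. p (\<omega> m) = a)" for a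
      unfolding eventually_sequentially by measurable
  qed (auto intro: eventually_const_unique)
  have "Measurable.pred ?M wins_fst" "Measurable.pred ?M wins_snd"
    unfolding wins_fst_def wins_snd_def eventually_sequentially by measurable
  then show ?thesis
    unfolding losing_number_def using lim by (intro measurable_If) (simp_all add: pred_def)
qed

lemma losing_tail_sums:
  "(\<lambda>k. bins_prob.prob f u {\<omega>. \<forall>\<^sub>F m in sequentially. fst (\<omega> m) = Suc n + k} +
        bins_prob.prob f u {\<omega>. \<forall>\<^sub>F m in sequentially. snd (\<omega> m) = Suc n + k})
   sums losing_tail f u n"
proof -
  let ?M = "bins_measure f u"
  let ?G = "{\<omega> \<in> space ?M. bins_path u \<omega>}"
  define X where "X a = {\<omega>. \<forall>\<^sub>F m in sequentially. fst (\<omega> m :: nat \<times> nat) = a}" for a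
  define Y where "Y a = {\<omega>. \<forall>\<^sub>F m in sequentially. snd (\<omega> m :: nat \<times> nat) = a}" for a
  have [measurable]: "p \<in> measurable (count_space UNIV) (count_space UNIV)" for p :: "nat \<times> nat \<Rightarrow> nat"
    by simp
  have "{\<omega> \<in> space ?M. \<forall>\<^sub>F m in sequentially. p (\<omega> m) = a} \<in> sets ?M" for p :: "nat \<times> nat \<Rightarrow> nat" and a
    unfolding eventually_sequentially by measurable
  from this[of fst] this[of snd] have sets: "X a \<in> sets ?M" "Y a \<in> sets ?M" for a
    by (simp_all add: X_def Y_def space_bins_measure)
  have [measurable]: "(\<lambda>s. (Suc (fst s), snd s)) \<in> measurable (count_space UNIV) (count_space (UNIV :: (nat \<times> nat) set))"
    "(\<lambda>s. (fst s, Suc (snd s))) \<in> measurable (count_space UNIV) (count_space (UNIV :: (nat \<times> nat) set))"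
    by simp_all
  have G: "?G \<in> sets ?M"
    unfolding bins_path_def by measurable
  have inter: "bins_prob.prob f u (A \<inter> ?G) = bins_prob.prob f u A" if "A \<in> sets ?M" for A
    using that G AE_bins_path[of u f]
    by (intro bins_prob.finite_measure_eq_AE) (auto simp: space_bins_measure)
  \<comment> \<open>Off genuine paths both coordinates can be eventually constant. Intersecting with
    \<open>?G\<close> makes the events disjoint everywhere without changing their
    probabilities.\<close>
  let ?F = "\<lambda>k. (X (Suc n + k) \<inter> ?G) \<union> (Y (Suc n + k) \<inter> ?G)"
  have disj: "X a \<inter> ?G \<inter> (Y b \<inter> ?G) = {}" for a b
    using bins_path_not_both_const[of u _ a b] by (auto simp: X_def Y_def)
  have disj': "X a \<inter> X b = {}" "Y a \<inter> Y b = {}" if "a \<noteq> b" for a b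
    using that eventually_const_unique[of _ a b] by (auto simp: X_def Y_def)
  have "disjoint_family ?F"
    unfolding disjoint_family_on_def
  proof (intro ballI impI)
    fix k l :: nat assume "k \<noteq> l"
    then have "Suc n + k \<noteq> Suc n + l" by simp
    from disj'[OF this] disj[of "Suc n + k" "Suc n + l"] disj[of "Suc n + l" "Suc n + k"]
    show "?F k \<inter> ?F l = {}" by blast
  qed
  moreover have F: "?F k \<in> sets ?M" for k
    by (intro sets.Un sets.Int sets G)
  ultimately have "(\<lambda>k. bins_prob.prob f u (?F k)) sums bins_prob.prob f u (\<Union>k. ?F k)"
    by (intro bins_prob.finite_measure_UNION) auto
  moreover have "bins_prob.prob f u (?F k) =
      bins_prob.prob f u (X (Suc n + k)) + bins_prob.prob f u (Y (Suc n + k))" for k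
  proof -
    have "bins_prob.prob f u (?F k) =
        bins_prob.prob f u (X (Suc n + k) \<inter> ?G) + bins_prob.prob f u (Y (Suc n + k) \<inter> ?G)"
      by (intro bins_prob.finite_measure_Union sets.Int sets G disj)
    then show ?thesis
      by (simp only: inter sets)
  qed
  moreover have "bins_prob.prob f u (\<Union>k. ?F k) = losing_tail f u n"
    unfolding losing_tail_def
  proof (rule bins_prob.finite_measure_eq_AE)
    show "AE \<omega> in ?M. \<omega> \<in> (\<Union>k. ?F k) \<longleftrightarrow> \<omega> \<in> {\<omega> \<in> space ?M. losing_number \<omega> > n}"
      using AE_bins_path
    proof eventually_elim
      case (elim \<omega>)
      then show ?case
        unfolding mem_Collect_eq losing_number_gt_iff[OF elim]
        by (simp add: space_bins_measure X_def Y_def)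
    qed
    show "(\<Union>k. ?F k) \<in> sets ?M"
      by (intro sets.countable_UN) (use F in auto)
    note measurable_losing_number [measurable]
    show "{\<omega> \<in> space ?M. losing_number \<omega> > n} \<in> sets ?M"
      by measurable
  qed
  ultimately show ?thesis
    by (simp add: X_def Y_def)
qed

section \<open>Tail asymptotics of the losing number\<close>

lemma abs_divide_minus_1_le:
  fixes u t d :: real
  assumes "\<bar>u - t\<bar> \<le> d * t" "t > 0"
  shows "\<bar>u / t - 1\<bar> \<le> d"
proof -
  have "u / t - 1 = (u - t) / t"
    using assms(2) by (simp add: diff_divide_distrib)
  then show ?thesis
    using assms by (simp add: abs_divide pos_divide_le_eq)
qed

text \<open>Beyond some index each weight is within a small relative error of \<open>c\<close>, and
  summing positive terms preserves that relative error.\<close>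

lemma weighted_suminf_asymp_equiv:
  fixes a r :: "nat \<Rightarrow> real"
  assumes sums: "\<And>n. (\<lambda>k. r (Suc n + k) * a (Suc n + k)) sums s n"
    and "r \<longlonglongrightarrow> c" "c > 0" "\<And>n. n \<ge> 1 \<Longrightarrow> a n > 0" "summable a"
  shows "s \<sim>[sequentially] (\<lambda>n. c * (\<Sum>k. a (Suc n + k)))"
proof -
  let ?T = "\<lambda>n. \<Sum>k. a (Suc n + k)"
  have summ: "summable (\<lambda>k. a (Suc n + k))" for n
    using assms(5) by (subst add.commute) (simp only: summable_iff_shift)
  have T_pos: "?T n > 0" for n
    using assms(4) by (intro suminf_pos summ) auto
  have "(\<lambda>n. s n / (c * ?T n)) \<longlonglongrightarrow> 1"
  proof (rule LIMSEQ_I)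
    fix e :: real assume "e > 0"
    \<comment> \<open>Summation yields only a weak inequality; \<open>e / 2\<close> leaves room for
      the strict one.\<close>
    then obtain N where N: "\<And>n. n \<ge> N \<Longrightarrow> \<bar>r n - c\<bar> < e / 2 * c"
      using LIMSEQ_D[OF assms(2), of "e / 2 * c"] assms(3) by auto
    show "\<exists>N. \<forall>n\<ge>N. norm (s n / (c * ?T n) - 1) < e"
    proof (intro exI allI impI)
      fix n assume "n \<ge> N"
      have "(\<lambda>k. r (Suc n + k) * a (Suc n + k) - c * a (Suc n + k)) sums (s n - c * ?T n)"
        by (intro sums_diff sums sums_mult summable_sums summ)
      then have sums': "(\<lambda>k. (r (Suc n + k) - c) * a (Suc n + k)) sums (s n - c * ?T n)"
        by (simp add: left_diff_distrib)
      have "norm (\<Sum>k. (r (Suc n + k) - c) * a (Suc n + k)) \<le> (\<Sum>k. e / 2 * c * a (Suc n + k))"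
      proof (rule norm_suminf_le)
        show "norm ((r (Suc n + k) - c) * a (Suc n + k)) \<le> e / 2 * c * a (Suc n + k)" for k
          using N[of "Suc n + k"] \<open>n \<ge> N\<close> assms(4)[of "Suc n + k"]
          by (simp add: abs_mult mult_right_mono)
        show "summable (\<lambda>k. e / 2 * c * a (Suc n + k))"
          by (intro summable_mult summ)
      qed
      also have "\<dots> = e / 2 * (c * ?T n)"
        using suminf_mult[OF summ, of "e / 2 * c" n] by (simp only: mult.assoc)
      finally have "\<bar>s n - c * ?T n\<bar> \<le> e / 2 * (c * ?T n)"
        using sums' by (simp add: sums_iff)
      moreover have "c * ?T n > 0" using assms(3) T_pos by simp
      ultimately have "\<bar>s n / (c * ?T n) - 1\<bar> \<le> e / 2"
        by (rule abs_divide_minus_1_le)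
      then show "norm (s n / (c * ?T n) - 1) < e"
        using \<open>e > 0\<close> by simp
    qed
  qed
  then show ?thesis by (rule asymp_equivI')
qed

lemma losing_tail_asymp_equiv:
  assumes f: "\<And>n. n \<ge> 1 \<Longrightarrow> f n > 0" and xy: "x \<ge> 1" "y \<ge> 1"
    and summ: "\<And>n. summable (\<lambda>j. 1 / f (n + j))"
  obtains c where "c > 0" "losing_tail f (x, y) \<sim>[sequentially] (\<lambda>n. c * S1 f (Suc n))"
proof -
  interpret fst: transient_meeting "\<lambda>i. f (x + i)" "\<lambda>j. f (y + j)"
    by (rule transient_meeting_shift[OF assms])
  interpret snd: transient_meeting "\<lambda>j. f (y + j)" "\<lambda>i. f (x + i)"
    by (rule transient_meeting_shift[OF f xy(2,1) summ])
  obtain c d where c: "c > 0" "fst.meet_lim \<longlonglongrightarrow> c" and d: "d > 0" "snd.meet_lim \<longlonglongrightarrow> d"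
    using fst.meet_lim_tendsto_pos snd.meet_lim_tendsto_pos by metis
  define p where "p a = bins_prob.prob f (x, y) {\<omega>. \<forall>\<^sub>F m in sequentially. fst (\<omega> m) = a} +
    bins_prob.prob f (x, y) {\<omega>. \<forall>\<^sub>F m in sequentially. snd (\<omega> m) = a}" for a
  \<comment> \<open>The restriction on \<open>a\<close> makes the truncated subtractions
    \<open>a - x\<close> and \<open>a - y\<close> exact.\<close>
  have p: "p a * f a = fst.meet_lim (a - x) + snd.meet_lim (a - y)" if "a \<ge> max x y" for a
    using prob_eventually_fst[OF assms, of "a - x"] prob_eventually_snd[OF assms, of "a - y"] that f[of a] xy
    by (simp add: p_def distrib_right)
  have "(\<lambda>a. fst.meet_lim (a - x) + snd.meet_lim (a - y)) \<longlonglongrightarrow> c + d"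
    using c d by (intro tendsto_add) (rule LIMSEQ_offset[of _ x], simp, rule LIMSEQ_offset[of _ y], simp)
  moreover have "\<forall>\<^sub>F a in sequentially. fst.meet_lim (a - x) + snd.meet_lim (a - y) = p a * f a"
    using eventually_ge_at_top[of "max x y"] by eventually_elim (simp only: p)
  ultimately have "(\<lambda>a. p a * f a) \<longlonglongrightarrow> c + d"
    by (rule Lim_transform_eventually)
  moreover have "(\<lambda>k. (p (Suc n + k) * f (Suc n + k)) * (1 / f (Suc n + k))) sums losing_tail f (x, y) n" for n
  proof -
    have "p (Suc n + k) * f (Suc n + k) * (1 / f (Suc n + k)) = p (Suc n + k)" for k
      using f[of "Suc n + k"] by simp
    then show ?thesis
      using losing_tail_sums[of f "(x, y)" n] unfolding p_def by (simp only:)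
  qed
  moreover have "summable (\<lambda>j. 1 / f j)"
    using summ[of 0] by simp
  ultimately have "losing_tail f (x, y) \<sim>[sequentially] (\<lambda>n. (c + d) * (\<Sum>k. 1 / f (Suc n + k)))"
    using c d f by (intro weighted_suminf_asymp_equiv[where a = "\<lambda>j. 1 / f j"]) auto
  then show ?thesis
    using c d by (intro that[of "c + d"]) (auto simp: S1_def)
qed

theorem theorem4:
  fixes f :: "nat \<Rightarrow> real" and x y :: nat
  assumes "valid_feedback f" and "x \<ge> 1" and "y \<ge> 1"
  shows "summable (\<lambda>j. 1 / f (Suc j)) \<and>
    (\<exists>c>0.
       (\<lambda>n. losing_tail f (x, y) n) \<sim>[sequentially] (\<lambda>n. c * S1 f n) \<and>
       (\<forall>g. valid_extension f g \<longrightarrow>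
          (\<lambda>n. c * S1 f n) \<sim>[sequentially]
          (\<lambda>n. c * (real n / ((char_exponent g (real n) - 1) * f n)))))"
proof -
  obtain g0 where "valid_extension f g0"
    using assms(1) by (auto simp: valid_feedback_def)
  then interpret feedback_extension f g0
    by unfold_locales
  \<comment> \<open>The constant is fixed before any extension \<open>g\<close> of the final claim,
    so the same \<open>c\<close> serves all of them.\<close>
  obtain c where c: "c > 0" "losing_tail f (x, y) \<sim>[sequentially] (\<lambda>n. c * S1 f (Suc n))"
    using losing_tail_asymp_equiv[OF f_pos assms(2,3) summable_inverse_f] .
  have "(\<lambda>n. c * S1 f (Suc n)) \<sim>[sequentially] (\<lambda>n. c * S1 f n)"
    by (intro asymp_equiv_intros S1_Suc_asymp_equiv)
  with c(2) have "(\<lambda>n. losing_tail f (x, y) n) \<sim>[sequentially] (\<lambda>n. c * S1 f n)"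
    by (rule asymp_equiv_trans)
  moreover have "(\<lambda>n. c * S1 f n) \<sim>[sequentially]
      (\<lambda>n. c * (real n / ((char_exponent g (real n) - 1) * f n)))" if "valid_extension f g" for g
    by (intro asymp_equiv_mult asymp_equiv_refl feedback_extension.S1_asymp_equiv
        feedback_extension.intro that)
  moreover have "summable (\<lambda>j. 1 / f (Suc j))"
    using summable_inverse_f[of 1] by simp
  ultimately show ?thesis
    using c(1) by blast
qed

end
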